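(* The $\mathbb S_N$-action on $\mathcal V_n$ given by $\{\boldsymbol s_j\}_{j=1}^{N-1}$, $\boldsymbol s_j=s_j\hat r_j$, permutes the (on-shell) Bethe vectors $|y_\alpha\rangle$ according to the natural $\mathbb S_N$-action on the 01-words $\alpha$, i.e. $\boldsymbol s_j|y_\alpha\rangle=|y_{p_j\alpha}\rangle$, where $p_j$ permutes the $j$-th and $(j+1)$-th letter in $\alpha$. In particular, $$s_\lambda(y_\alpha|t)-s_j\cdot s_\lambda(y_{p_j\alpha}|t)=(t_j-t_{j+1})\,s_{\delta_j\lambda}(y_\alpha|t),\qquad j=1,\dots,N-1,$$ where $s_{\delta_j\lambda}(y_\alpha|t)$ is set to $0$ if $\delta_j|\lambda\rangle=0$.
   Context: $N=n+k$; $T_1,\dots,T_N$ are indeterminates (equivariant parameters), $t_i:=T_{N+1-i}$. $V$ has basis $v_0,v_1$; $V_n$ is the span of $v_{\varepsilon_1}\otimes\cdots\otimes v_{\varepsilon_N}$ with exactly $n$ of the $\varepsilon_j\in\{0,1\}$ equal to 1, and $\mathcal V_n=\mathbb Z[T_1,\dots,T_N][q]\otimes V_n$, with scalars extended to $\mathbb F_q$ below. $\Pi_{n,k}=\{\lambda:k\ge\lambda_1\ge\dots\ge\lambda_n\ge0\}$, $I(\lambda)=\{\lambda_{n+1-i}+i:1\le i\le n\}$; the 01-word of $\lambda$ is $\varepsilon_1\cdots\varepsilon_N$ with $\varepsilon_j=1$ iff $j\in I(\lambda)$, and $|\lambda\rangle=v_{\varepsilon_1}\otimes\cdots\otimes v_{\varepsilon_N}$;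 $\lambda^\vee=(k-\lambda_n,\dots,k-\lambda_1)$. Here $\lambda,\alpha\in\Pi_{n,k}$, and partitions are identified with their 01-words. With $\sigma^+v_0=v_1$, $\sigma^+v_1=0$, $\sigma^-v_1=v_0$, $\sigma^-v_0=0$: $\delta_j=\sigma_j^-\sigma_{j+1}^+$, i.e. $\delta_j|\lambda\rangle$ is the basis vector with letters $j,j+1$ exchanged if $\varepsilon_j>\varepsilon_{j+1}$ and $0$ otherwise; when it is nonzero, $\delta_j\lambda$ denotes the corresponding partition. $\delta_j^\vee=\sigma_j^+\sigma_{j+1}^-$ (letters $j,j+1$ exchanged if $\varepsilon_j<\varepsilon_{j+1}$, $0$ otherwise), $\hat r_j=1-(t_j-t_{j+1})\delta_j^\vee$, and $s_j$ exchanges $t_j,t_{j+1}$ in coefficients, acting trivially on the basis vectors and on $q$. $\mathbb F_q=\mathbb C[q^{\pm1/N}]\widehat\otimes\mathbb C\{\!\{T_1,\dots,T_N\}\!\}$ (completed tensor product with the algebraically closed field of Puiseux series), to which the action of $s_j$ is extended. Bethe roots: $y_1,\dots,y_N$ are the solutions of $\prod_{j=1}^N(y-t_j)+(-1)^nq=0$, numbered by $y_j|_{q=0}=t_j$; permutations of the $t$'s act on them accordingly, $s_iy_j=y_{s_i(j)}$. $y_\alpha=(y_i)_{i\in I(\alpha)}$. The on-shell Bethe vectors are $|y_\alpha\rangle=\sum_{\lambda\in\Pi_{n,k}}s_{\lambda^\vee}(y_\alpha|T)|\lambda\rangle$, where $s_\lambda(x|a)=\det[(x_j|a)^{\lambda_i+n-i}]_{1\le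 i,j\le n}/\det[(x_j|a)^{n-i}]_{1\le i,j\le n}$, $(x|a)^r=\prod_{i=1}^r(x-a_i)$ (factorial Schur function), with $a=T$ or $a=t$. The expression $s_j\cdot s_\lambda(y_{p_j\alpha}|t)$ means $s_j$ applied to the element $s_\lambda(y_{p_j\alpha}|t)$.
   Formalization: The displayed formula fails as printed (n=k=1, λ=(0), j=1); it is proved with right side (t_{j+1}-t_j) s_{δ_j^∨λ}(y_α|t), 0 if δ_j^∨|λ⟩=0, and also with λ replaced by λ^∨, δ_jλ by (δ_jλ)^∨ and s(·|t) by s(·|T), keeping the factor t_j-t_{j+1}. *)

theory Defs
  imports
    Complex_Main
    "HOL-Computational_Algebra.Formal_Laurent_Series"
    "HOL-Algebra.Sym_Groups"
    "HOL-Algebra.Group_Action"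
    "Jordan_Normal_Form.Determinant"
begin

section \<open>Partitions in the n by k box and 01-words\<close>

text \<open>
  A partition \<open>(l_1, ..., l_n)\<close> is the list of its \<open>n\<close> parts (zeros included), so \<open>l_i\<close> is
  \<open>l ! (i - 1)\<close>. A 01-word of length \<open>n + k\<close> is an extensional function on the positions
  \<open>{1..n + k}\<close>.
\<close>

definition partitions_in_box :: "nat \<Rightarrow> nat \<Rightarrow> nat list set" where
  "partitions_in_box n k = {l. length l = n \<and> sorted_wrt (\<ge>) l \<and> (\<forall>x\<in>set l. x \<le> k)}"

definition one_positions :: "nat \<Rightarrow> nat list \<Rightarrow> nat set" where
  "one_positions n l = (\<lambda>i. l ! (n - i) + i) ` {1..n}"

definition words01 :: "nat \<Rightarrow> nat \<Rightarrow> (nat \<Rightarrow> nat) set" where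
  "words01 n k = {e \<in> {1..n + k} \<rightarrow>\<^sub>E {0, 1}. card {j \<in> {1..n + k}. e j = 1} = n}"

definition word01 :: "nat \<Rightarrow> nat \<Rightarrow> nat list \<Rightarrow> (nat \<Rightarrow> nat)" where
  "word01 n k l = (\<lambda>j\<in>{1..n + k}. if j \<in> one_positions n l then 1 else 0)"

definition partition_of_word :: "nat \<Rightarrow> nat \<Rightarrow> (nat \<Rightarrow> nat) \<Rightarrow> nat list" where
  "partition_of_word n k e = (THE l. l \<in> partitions_in_box n k \<and> word01 n k l = e)"

definition swap_letters :: "nat \<Rightarrow> nat \<Rightarrow> nat \<Rightarrow> nat list \<Rightarrow> nat list" where
  "swap_letters n k j l = partition_of_word n k (word01 n k l \<circ> transpose j (Suc j))"

definition dual_partition :: "nat \<Rightarrow> nat list \<Rightarrow> nat list" where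
  "dual_partition k l = rev (map (\<lambda>x. k - x) l)"


section \<open>Operators on tensors\<close>

text \<open>
  An element of the \<open>N\<close>-fold tensor power of \<open>V\<close> over a ring \<open>'r\<close> is the function giving its
  coefficients in the basis indexed by 01-words. The letter \<open>e j\<close> of the output word determines
  which input coefficient contributes to it.
\<close>

type_synonym 'r tensor = "(nat \<Rightarrow> nat) \<Rightarrow> 'r"

definition ket :: "(nat \<Rightarrow> nat) \<Rightarrow> 'r::zero_neq_one tensor" where
  "ket e = (\<lambda>e'. if e' = e then 1 else 0)"

definition sigma_plus :: "nat \<Rightarrow> 'r::zero tensor \<Rightarrow> 'r tensor" where
  "sigma_plus j f = (\<lambda>e. if e j = 1 then f (e(j := 0)) else 0)"

definition sigma_minus :: "nat \<Rightarrow> 'r::zero tensor \<Rightarrow> 'r tensor" where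
  "sigma_minus j f = (\<lambda>e. if e j = 0 then f (e(j := 1)) else 0)"

definition delta :: "nat \<Rightarrow> 'r::zero tensor \<Rightarrow> 'r tensor" where
  "delta j f = sigma_minus j (sigma_plus (Suc j) f)"

definition delta_dual :: "nat \<Rightarrow> 'r::zero tensor \<Rightarrow> 'r tensor" where
  "delta_dual j f = sigma_plus j (sigma_minus (Suc j) f)"

definition r_hat :: "(nat \<Rightarrow> 'r::comm_ring_1) \<Rightarrow> nat \<Rightarrow> 'r tensor \<Rightarrow> 'r tensor" where
  "r_hat t j f = (\<lambda>e. f e - (t j - t (Suc j)) * delta_dual j f e)"

definition bold_s ::
  "(nat \<Rightarrow> 'r \<Rightarrow> 'r) \<Rightarrow> (nat \<Rightarrow> 'r::comm_ring_1) \<Rightarrow> nat \<Rightarrow> 'r tensor \<Rightarrow> 'r tensor" where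
  "bold_s s t j f = (\<lambda>e. s j (r_hat t j f e))"

text \<open>
  Directions: \<open>delta j\<close> moves a letter 1 to the right, so it adds a box to the partition, and
  \<open>delta_dual j\<close> removes one. The difference \<open>s_l(y|t) - s_j s_l(y|t)\<close> is homogeneous of degree
  \<open>|l|\<close>, hence a multiple \<open>(t_{j+1} - t_j) s_m(y|t)\<close> with \<open>m\<close> obtained from \<open>l\<close> by removing a box,
  i.e. by \<open>delta_dual j\<close>. The operator \<open>delta j\<close> itself appears, with the factor \<open>t_j - t_{j+1}\<close>,
  when one compares coefficients of \<open>|l>\<close> in Bethe vectors, which are functions of the dual
  partition and of the parameters \<open>T\<close>. The printed form of the difference formula, with
  \<open>(t_j - t_{j+1}) s_m(y|t)\<close> and \<open>m\<close> obtained from \<open>l\<close> by \<open>delta j\<close>, fails already for \<open>l = (0)\<close>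
  and \<open>n = k = 1\<close>: the left side is 0, the right side is \<open>(t_1 - t_2)(y - t_1)\<close>.
\<close>

text \<open>
  For an operator \<open>D\<close> (below \<open>delta j\<close> or \<open>delta_dual j\<close>) with \<open>D |l> \<noteq> 0\<close>, the partition \<open>m\<close>
  with \<open>D |l> = |m>\<close>.
\<close>

definition image_partition ::
  "nat \<Rightarrow> nat \<Rightarrow> ('r::zero_neq_one tensor \<Rightarrow> 'r tensor) \<Rightarrow> nat list \<Rightarrow> nat list" where
  "image_partition n k D l =
     (THE m. m \<in> partitions_in_box n k \<and> D (ket (word01 n k l)) = ket (word01 n k m))"

inductive_set int_polys :: "nat \<Rightarrow> (nat \<Rightarrow> 'r::comm_ring_1) \<Rightarrow> 'r \<Rightarrow> 'r set"
  for N :: nat and T :: "nat \<Rightarrow> 'r" and q :: 'r where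
  const: "of_int c \<in> int_polys N T q"
| param: "i \<in> {1..N} \<Longrightarrow> T i \<in> int_polys N T q"
| quantum: "q \<in> int_polys N T q"
| add: "a \<in> int_polys N T q \<Longrightarrow> b \<in> int_polys N T q \<Longrightarrow> a + b \<in> int_polys N T q"
| mult: "a \<in> int_polys N T q \<Longrightarrow> b \<in> int_polys N T q \<Longrightarrow> a * b \<in> int_polys N T q"

definition weight_module :: "nat \<Rightarrow> nat \<Rightarrow> (nat \<Rightarrow> 'r::comm_ring_1) \<Rightarrow> 'r \<Rightarrow> 'r tensor set" where
  "weight_module n k T q =
     {f. (\<forall>e. f e \<in> int_polys (n + k) T q) \<and> (\<forall>e. e \<notin> words01 n k \<longrightarrow> f e = 0)}"


section \<open>Factorial Schur functions and Bethe vectors\<close>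

definition factorial_power :: "'r::comm_ring_1 \<Rightarrow> (nat \<Rightarrow> 'r) \<Rightarrow> nat \<Rightarrow> 'r" where
  "factorial_power x a r = (\<Prod>i=1..r. x - a i)"

text \<open>Matrix rows and columns are numbered from 0, hence the exponent \<open>n - Suc i\<close>.\<close>

definition factorial_schur :: "nat list \<Rightarrow> 'r::field list \<Rightarrow> (nat \<Rightarrow> 'r) \<Rightarrow> 'r" where
  "factorial_schur l x a = (let n = length x in
     det (mat n n (\<lambda>(i, j). factorial_power (x ! j) a (l ! i + (n - Suc i)))) /
     det (mat n n (\<lambda>(i, j). factorial_power (x ! j) a (n - Suc i))))"

definition root_tuple :: "nat \<Rightarrow> (nat \<Rightarrow> 'r) \<Rightarrow> nat list \<Rightarrow> 'r list" where
  "root_tuple n y l = map y (sorted_list_of_set (one_positions n l))"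

definition bethe_vector ::
  "nat \<Rightarrow> nat \<Rightarrow> (nat \<Rightarrow> 'r::field) \<Rightarrow> (nat \<Rightarrow> 'r) \<Rightarrow> nat list \<Rightarrow> 'r tensor" where
  "bethe_vector n k T y \<alpha> = (\<lambda>e. \<Sum>l\<in>partitions_in_box n k.
     factorial_schur (dual_partition k l) (root_tuple n y \<alpha>) T * ket (word01 n k l) e)"


section \<open>The coefficient field\<close>

text \<open>
  The coefficient field is \<open>K((q\<^bsup>1/N\<^esup>))\<close>, that is \<open>'k fls\<close> with the formal variable \<open>fls_X\<close> in the
  role of the \<open>N\<close>-th root of \<open>q\<close>. Here \<open>K\<close> is an arbitrary algebraically closed extension of the
  complex numbers, embedded by \<open>\<iota>\<close>, with algebraically independent elements \<open>T_1, ..., T_N\<close>;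
  Puiseux series in \<open>T_1, ..., T_N\<close> are such a field.
\<close>

definition alg_independent :: "(complex \<Rightarrow> 'k::field) \<Rightarrow> nat \<Rightarrow> (nat \<Rightarrow> 'k) \<Rightarrow> bool" where
  "alg_independent \<iota> N T \<longleftrightarrow>
     (\<forall>M c. finite M \<and> M \<subseteq> ({1..N} \<rightarrow>\<^sub>E (UNIV :: nat set)) \<and>
        (\<Sum>m\<in>M. \<iota> (c m) * (\<Prod>i=1..N. T i ^ m i)) = 0 \<longrightarrow> (\<forall>m\<in>M. c m = 0))"

text \<open>
  Automorphisms of \<open>K\<close> that restrict to the exchanges of \<open>t_j\<close> and \<open>t_{j+1}\<close>. The relations of the
  symmetric group are not required on all of \<open>K\<close>: by the Artin-Schreier theorem no algebraically
  closed \<open>K\<close> would satisfy them for \<open>N \<ge> 2\<close>, given that the complex numbers are fixed. They hold on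
  the subfield generated by the \<open>T_i\<close>.
\<close>

definition extends_exchanges ::
  "(complex \<Rightarrow> 'k::field) \<Rightarrow> nat \<Rightarrow> (nat \<Rightarrow> 'k) \<Rightarrow> (nat \<Rightarrow> 'k \<Rightarrow> 'k) \<Rightarrow> bool" where
  "extends_exchanges \<iota> N t s \<longleftrightarrow>
     (\<forall>j\<in>{1..<N}. field_hom (s j) \<and> bij (s j) \<and> (\<forall>c. s j (\<iota> c) = \<iota> c) \<and>
        (\<forall>i\<in>{1..N}. s j (t i) = t (transpose j (Suc j) i)))"

definition fls_map_coeffs :: "('k::zero \<Rightarrow> 'k) \<Rightarrow> 'k fls \<Rightarrow> 'k fls" where
  "fls_map_coeffs g f = Abs_fls (\<lambda>m. g (fls_nth f m))"

text \<open>
  \<open>y_1, ..., y_N\<close> are the solutions of \<open>\<Prod>(y - t_j) + (-1)^n q = 0\<close>, numbered by \<open>y_j = t_j\<close> at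
  \<open>q = 0\<close>; specialising at \<open>q = 0\<close> means having no polar part and taking the constant term.
\<close>

definition bethe_roots :: "nat \<Rightarrow> nat \<Rightarrow> (nat \<Rightarrow> 'k::field) \<Rightarrow> (nat \<Rightarrow> 'k fls) \<Rightarrow> bool" where
  "bethe_roots n N t y \<longleftrightarrow>
     {z. (\<Prod>j=1..N. z - fls_const (t j)) + (- 1) ^ n * fls_X ^ N = 0} = y ` {1..N} \<and>
     (\<forall>j\<in>{1..N}. fls_subdegree (y j) \<ge> 0 \<and> fls_nth (y j) 0 = t j)"

end

theory Submission
  imports Defs
begin

text \<open>
  Everything rests on one observation about the factorial powers \<open>(x|t)\<^sup>r\<close>. Exchanging \<open>t_j\<close> and
  \<open>t_{j+1}\<close> while \<open>x\<close> stays put changes \<open>(x|t)\<^sup>r\<close> only for \<open>r = j\<close>, where its last factor \<open>x - t_j\<close>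
  becomes \<open>x - t_{j+1}\<close>; so it adds \<open>(t_j - t_{j+1}) (x|t)\<^sup>j\<^sup>-\<^sup>1\<close> (\<open>factorial_power_adj\<close>).

  Index the rows of the determinant \<open>det [(x_c|t)\<^sup>p\<^sup>-\<^sup>1]\<close> by the positions \<open>p\<close> of the letters 1 in a
  01-word. The exchange then affects only the row of position \<open>j + 1\<close>, to which it adds a multiple
  of the row of position \<open>j\<close>. The correction vanishes if \<open>j\<close> is itself a position of a letter 1, and
  otherwise it is the determinant of the word with letters \<open>j\<close> and \<open>j + 1\<close> swapped
  (\<open>hom_alternant_adj\<close>). The denominator of a factorial Schur function belongs to the positions
  \<open>1, ..., n\<close>, which contain \<open>j\<close> whenever they contain \<open>j + 1\<close>, so it is not changed. Hence a field
  automorphism \<open>h\<close> that exchanges \<open>t_j\<close> and \<open>t_{j+1}\<close> maps \<open>s_l(x|t)\<close> to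
  \<open>s_l(h x|t) + (t_j - t_{j+1}) s_m(h x|t)\<close>, where \<open>m\<close> is obtained from \<open>l\<close> by \<open>delta_dual j\<close> and the
  second term is absent if there is no such \<open>m\<close> (\<open>hom_factorial_schur\<close>).

  The Bethe equation is symmetric in the \<open>t_i\<close>, and its solutions are told apart by their distinct
  constant terms; so \<open>s_j\<close> carries \<open>y_i\<close> to \<open>y_{s_j(i)}\<close>, and the tuple of roots of a word to a
  rearrangement of the tuple of the swapped word. This gives the difference formula for the
  parameters \<open>t\<close>. Passing to the dual partition reverses the word, as passing from \<open>t\<close> to \<open>T\<close>
  reverses the parameters, which gives the formula for \<open>T\<close>. In the coefficients of a Bethe vector
  the correction of the exchange formula cancels against the one made by \<open>r_hat\<close>, so \<open>bold_s\<close>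
  permutes the Bethe vectors.

  For the group action, the relations of the symmetric group are not verified on generators; between
  the given automorphisms they need not even hold on the whole field. Instead a vector is paired
  with the determinants above, evaluated at a tuple of natural numbers. The exchange formula says
  that under this pairing \<open>bold_s s t j\<close> becomes \<open>s j\<close> acting on values
  (\<open>alternant_pairing_bold_s\<close>). The values at all such tuples determine the vector, because the
  factorial powers \<open>(x|t)\<^sup>0, ..., (x|t)\<^sup>N\<^sup>-\<^sup>1\<close> are linearly independent as functions of natural numbers
  \<open>x < N\<close> (\<open>alternant_pairing_faithful\<close>). Values of vectors in the weight module are integral polynomials
  in \<open>T\<close> and \<open>q\<close>, on which a ring homomorphism is determined by the permutation of the \<open>t_i\<close> that it
  induces. So a product of operators \<open>bold_s\<close> depends only on the corresponding permutation.
\<close>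

section \<open>Partitions, 01-words and adjacent exchanges\<close>

abbreviation (input) adj_transp :: "nat \<Rightarrow> nat \<Rightarrow> nat" where
  "adj_transp j \<equiv> transpose j (Suc j)"

lemma adj_image_image: "adj_transp j ` adj_transp j ` S = S"
  by (simp add: image_image)

lemma mem_adj_image_iff: "p \<in> adj_transp j ` S \<longleftrightarrow> adj_transp j p \<in> S"
  by (metis adj_image_image imageI transpose_involutory)

definition position_sets :: "nat \<Rightarrow> nat \<Rightarrow> nat set set" where
  "position_sets n N = {S. S \<subseteq> {1..N} \<and> card S = n}"

lemma finite_position_sets: "finite (position_sets n N)"
  by (rule finite_subset[of _ "Pow {1..N}"]) (auto simp: position_sets_def)

lemma position_sets_finite: "S \<in> position_sets n N \<Longrightarrow> finite S"
  by (auto simp: position_sets_def intro: finite_subset)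

lemma adj_mem_iff: "j \<in> {1..<N} \<Longrightarrow> adj_transp j p \<in> {1..N} \<longleftrightarrow> p \<in> {1..N}"
  by (auto simp: transpose_def)

lemma adj_position_sets:
  assumes "j \<in> {1..<N}" "S \<in> position_sets n N"
  shows "adj_transp j ` S \<in> position_sets n N"
proof -
  have "adj_transp j ` S \<subseteq> {1..N}"
    using assms adj_mem_iff[OF assms(1)] by (auto simp: position_sets_def)
  moreover have "card (adj_transp j ` S) = n"
    using assms by (simp add: position_sets_def card_image)
  ultimately show ?thesis by (simp add: position_sets_def)
qed

lemma strict_sorted_gap:
  fixes ps :: "nat list"
  assumes "sorted_wrt (<) ps" "i \<le> i'" "i' < length ps"
  shows "ps ! i + (i' - i) \<le> ps ! i'"
  using assms(2,3)
proof (induction i' rule: dec_induct)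
  case (step m)
  then show ?case
    using sorted_wrt_nth_less[OF assms(1), of m "Suc m"] by force
qed simp

lemma sorted_list_of_one_positions:
  assumes "l \<in> partitions_in_box n k"
  shows "sorted_list_of_set (one_positions n l) = map (\<lambda>i. l ! (n - i) + i) [1..<Suc n]"
proof -
  let ?f = "\<lambda>i. l ! (n - i) + i"
  have mono: "?f i < ?f i'" if "i \<in> {1..n}" "i' \<in> {1..n}" "i < i'" for i i'
  proof -
    have "l ! (n - i') \<ge> l ! (n - i)"
      using assms that sorted_wrt_nth_less[of "(\<ge>)" l "n - i'" "n - i"]
      by (auto simp: partitions_in_box_def)
    then show ?thesis using that by linarith
  qed
  have "sorted_wrt (<) (map ?f [1..<Suc n])"
    unfolding sorted_wrt_iff_nth_less
  proof (intro allI impI)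
    fix i i' assume "i < i'" "i' < length (map ?f [1..<Suc n])"
    then show "map ?f [1..<Suc n] ! i < map ?f [1..<Suc n] ! i'"
      using mono[of "Suc i" "Suc i'"] by (simp del: upt_Suc)
  qed
  moreover have "one_positions n l = set (map ?f [1..<Suc n])"
    by (auto simp: one_positions_def)
  ultimately show ?thesis
    by (metis sorted_list_of_set.idem_if_sorted_distinct strict_sorted_iff)
qed

lemma one_positions_in_position_sets:
  assumes "l \<in> partitions_in_box n k"
  shows "one_positions n l \<in> position_sets n (n + k)"
proof -
  have "card (one_positions n l) = n"
    using arg_cong[OF sorted_list_of_one_positions[OF assms], of length] by simp
  moreover have "l ! (n - i) + i \<in> {1..n + k}" if "i \<in> {1..n}" for i
  proof -
    have "l ! (n - i) \<in> set l" using assms that by (auto simp: partitions_in_box_def)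
    then have "l ! (n - i) \<le> k" using assms by (auto simp: partitions_in_box_def)
    then show ?thesis using that by auto
  qed
  ultimately show ?thesis by (auto simp: position_sets_def one_positions_def)
qed

lemma one_positions_inj:
  assumes "l \<in> partitions_in_box n k" "m \<in> partitions_in_box n k"
    and "one_positions n l = one_positions n m"
  shows "l = m"
proof (rule nth_equalityI)
  show "length l = length m" using assms by (simp add: partitions_in_box_def)
  fix i assume "i < length l"
  then have i: "i < n" using assms by (simp add: partitions_in_box_def)
  have "map (\<lambda>i. l ! (n - i) + i) [1..<Suc n] = map (\<lambda>i. m ! (n - i) + i) [1..<Suc n]"
    using assms sorted_list_of_one_positions by metis
  then have "\<forall>i'\<in>{1..n}. l ! (n - i') = m ! (n - i')"
    by (auto simp del: upt_Suc)
  then have "l ! (n - (n - i)) = m ! (n - (n - i))" using i by (metis One_nat_def Suc_leI atLeastAtMost_iff diff_le_self zero_less_diff)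
  then show "l ! i = m ! i" using i by simp
qed

text \<open>
  The parts of the partition are the excesses \<open>p_i - i\<close> of the increasing list of positions. They
  are weakly increasing and lie between 0 and \<open>k\<close> because consecutive positions differ by at least 1
  and all of them lie between 1 and \<open>n + k\<close>.
\<close>

lemma one_positions_surj:
  assumes "S \<in> position_sets n (n + k)"
  obtains l where "l \<in> partitions_in_box n k" "one_positions n l = S"
proof -
  define ps where "ps = sorted_list_of_set S"
  have fin: "finite S" and S: "S \<subseteq> {1..n + k}" and card: "card S = n"
    using assms by (auto simp: position_sets_def intro: finite_subset)
  have ps: "sorted_wrt (<) ps" "set ps = S" "length ps = n"
    using fin card by (simp_all add: ps_def)
  have bounds: "Suc i \<le> ps ! i" "ps ! i \<le> k + Suc i" if "i < n" for i
  proof -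
    have "ps ! 0 \<in> S" "ps ! (n - 1) \<in> S" using ps that by (metis nth_mem gr_implies_not0 not_gr_zero, metis nth_mem diff_less gr_implies_not0 less_one not_gr_zero)
    then have "1 \<le> ps ! 0" "ps ! (n - 1) \<le> n + k" using S by auto
    then show "Suc i \<le> ps ! i" "ps ! i \<le> k + Suc i"
      using strict_sorted_gap[OF ps(1), of 0 i] strict_sorted_gap[OF ps(1), of i "n - 1"] that ps(3)
      by linarith+
  qed
  define l where "l = map (\<lambda>i. ps ! (n - Suc i) - (n - i)) [0..<n]"
  have lnth: "l ! i = ps ! (n - Suc i) - (n - i)" if "i < n" for i using that by (simp add: l_def)
  have "l ! i \<ge> l ! i'" if "i < i'" "i' < n" for i i'
  proof -
    have "ps ! (n - Suc i') + (i' - i) \<le> ps ! (n - Suc i)"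
      using strict_sorted_gap[OF ps(1), of "n - Suc i'" "n - Suc i"] that ps(3) by simp
    then show ?thesis using that by (simp add: lnth)
  qed
  moreover have "l ! i \<le> k" if "i < n" for i
    using bounds[of "n - Suc i"] that by (simp add: lnth)
  ultimately have box: "l \<in> partitions_in_box n k"
    by (auto simp: partitions_in_box_def sorted_wrt_iff_nth_less all_set_conv_all_nth l_def)
  have "l ! (n - i) + i = ps ! (i - 1)" if "i \<in> {1..n}" for i
  proof -
    have "i - 1 < n" using that by auto
    then show ?thesis using that bounds(1)[of "i - 1"] by (simp add: lnth)
  qed
  then have "one_positions n l = (\<lambda>i. ps ! (i - 1)) ` {1..n}"
    unfolding one_positions_def by (rule image_cong[OF refl])
  also have "\<dots> = (\<lambda>i. ps ! i) ` {..<n}"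
    by (force simp: image_iff intro: bexI[of _ "Suc _"])
  also have "\<dots> = S" using ps by (metis nth_image lessThan_atLeast0 order_refl take_all)
  finally show ?thesis using box that by blast
qed

text \<open>
  Complementing the parts in the box and reversing their order reads the 01-word backwards.
\<close>

lemma one_positions_dual:
  assumes "l \<in> partitions_in_box n k"
  shows "one_positions n (dual_partition k l) = (\<lambda>p. n + k + 1 - p) ` one_positions n l"
proof -
  have len: "length l = n" using assms by (simp add: partitions_in_box_def)
  have "dual_partition k l ! (n - i) + i = n + k + 1 - (l ! (i - 1) + (n + 1 - i))"
    if "i \<in> {1..n}" for i
  proof -
    have "l ! (i - 1) \<le> k"
      using assms that len by (auto simp: partitions_in_box_def all_set_conv_all_nth)
    moreover have "dual_partition k l ! (n - i) = k - l ! (i - 1)"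
      using that len by (auto simp: dual_partition_def rev_nth)
    ultimately show ?thesis using that by auto
  qed
  then have "one_positions n (dual_partition k l)
      = (\<lambda>i. n + k + 1 - (l ! (i - 1) + (n + 1 - i))) ` {1..n}"
    unfolding one_positions_def by (rule image_cong[OF refl])
  also have "\<dots> = (\<lambda>i. n + k + 1 - (l ! (n - i) + i)) ` (\<lambda>i. n + 1 - i) ` {1..n}"
    unfolding image_image by (rule image_cong) auto
  also have "(\<lambda>i. n + 1 - i) ` {1..n} = {1..n}"
  proof (intro equalityI subsetI)
    fix i assume "i \<in> {1..n}"
    then show "i \<in> (\<lambda>i. n + 1 - i) ` {1..n}"
      by (intro image_eqI[of _ _ "n + 1 - i"]) auto
  qed auto
  finally show ?thesis by (simp add: one_positions_def image_image)
qed

lemma dual_in_box: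
  assumes "l \<in> partitions_in_box n k"
  shows "dual_partition k l \<in> partitions_in_box n k"
proof -
  have "sorted_wrt (\<lambda>x y. k - y \<ge> k - x) l"
    by (rule sorted_wrt_mono_rel[of _ "(\<ge>)"]) (use assms in \<open>auto simp: partitions_in_box_def\<close>)
  then show ?thesis
    using assms by (auto simp: partitions_in_box_def dual_partition_def sorted_wrt_rev sorted_wrt_map)
qed

definition word_of_set :: "nat \<Rightarrow> nat set \<Rightarrow> nat \<Rightarrow> nat" where
  "word_of_set N S = (\<lambda>j\<in>{1..N}. if j \<in> S then 1 else 0)"

lemma word01_eq: "word01 n k l = word_of_set (n + k) (one_positions n l)"
  by (simp add: word01_def word_of_set_def)

lemma word_of_set_eq_1_iff: "j \<in> {1..N} \<Longrightarrow> word_of_set N S j = 1 \<longleftrightarrow> j \<in> S"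
  and word_of_set_eq_0_iff: "j \<in> {1..N} \<Longrightarrow> word_of_set N S j = 0 \<longleftrightarrow> j \<notin> S"
  by (auto simp: word_of_set_def)

lemma word_of_set_inj:
  assumes "S \<subseteq> {1..N}" "S' \<subseteq> {1..N}" "word_of_set N S = word_of_set N S'"
  shows "S = S'"
  using assms word_of_set_eq_1_iff by (metis subset_antisym subset_iff)

lemma word_of_set_adj:
  assumes "j \<in> {1..<N}"
  shows "word_of_set N S \<circ> adj_transp j = word_of_set N (adj_transp j ` S)"
  using adj_mem_iff[OF assms] by (auto simp: word_of_set_def fun_eq_iff mem_adj_image_iff restrict_def)

lemma words01_eq: "words01 n k = word_of_set (n + k) ` position_sets n (n + k)"
proof (intro equalityI subsetI)
  fix e assume e: "e \<in> words01 n k"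
  let ?S = "{j \<in> {1..n + k}. e j = 1}"
  have "e = word_of_set (n + k) ?S"
  proof
    fix j show "e j = word_of_set (n + k) ?S j"
      using e by (cases "j \<in> {1..n + k}") (auto simp: words01_def word_of_set_def PiE_def extensional_def Pi_iff)
  qed
  moreover have "?S \<in> position_sets n (n + k)"
    using e by (auto simp: words01_def position_sets_def)
  ultimately show "e \<in> word_of_set (n + k) ` position_sets n (n + k)" by blast
next
  fix e assume "e \<in> word_of_set (n + k) ` position_sets n (n + k)"
  then obtain S where S: "S \<subseteq> {1..n + k}" "card S = n" "e = word_of_set (n + k) S"
    by (auto simp: position_sets_def)
  then have "{j \<in> {1..n + k}. e j = 1} = S" using word_of_set_eq_1_iff[of _ "n + k" S] by blast
  then show "e \<in> words01 n k" using S by (auto simp: words01_def word_of_set_def)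
qed

lemma word01_inj:
  assumes "l \<in> partitions_in_box n k" "m \<in> partitions_in_box n k" "word01 n k l = word01 n k m"
  shows "l = m"
  using assms one_positions_in_position_sets
  by (intro one_positions_inj[OF assms(1,2)] word_of_set_inj[of _ "n + k"])
    (auto simp: word01_eq position_sets_def)

text \<open>
  Since 01-words with \<open>n\<close> letters 1 correspond bijectively to partitions in the box, the definite
  description in \<open>swap_letters\<close> is well defined, and on positions it is the image under a
  transposition.
\<close>

lemma swap_letters:
  assumes "j \<in> {1..<n + k}" "l \<in> partitions_in_box n k"
  shows "swap_letters n k j l \<in> partitions_in_box n k" (is ?box)
    and "one_positions n (swap_letters n k j l) = adj_transp j ` one_positions n l" (is ?pos)
proof -
  obtain m where m: "m \<in> partitions_in_box n k" "one_positions n m = adj_transp j ` one_positions n l"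
    using one_positions_surj adj_position_sets one_positions_in_position_sets assms by metis
  have w: "word01 n k m = word01 n k l \<circ> adj_transp j"
    using word_of_set_adj[OF assms(1)] by (simp add: word01_eq m(2))
  have "swap_letters n k j l = m"
    unfolding swap_letters_def partition_of_word_def
    by (rule the_equality) (use m w word01_inj in auto)
  then show ?box ?pos using m by auto
qed

lemma word01_swap_letters:
  assumes "j \<in> {1..<n + k}" "l \<in> partitions_in_box n k"
  shows "word01 n k (swap_letters n k j l) = word01 n k l \<circ> adj_transp j"
  using swap_letters(2)[OF assms] word_of_set_adj[OF assms(1)] by (simp add: word01_eq)

lemma swap_letters_swap_letters:
  assumes "j \<in> {1..<n + k}" "l \<in> partitions_in_box n k"
  shows "swap_letters n k j (swap_letters n k j l) = l"
  using assms by (intro one_positions_inj[of _ n k]) (simp_all add: swap_letters image_image)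

lemma dual_swap_letters:
  assumes "j \<in> {1..<n + k}" "l \<in> partitions_in_box n k"
  shows "swap_letters n k (n + k - j) (dual_partition k l) = dual_partition k (swap_letters n k j l)"
proof -
  have j': "n + k - j \<in> {1..<n + k}" using assms(1) by auto
  have refl: "adj_transp (n + k - j) (n + k + 1 - p) = n + k + 1 - adj_transp j p" if "p \<in> {1..n + k}" for p
    using assms(1) that by (auto simp: transpose_def)
  have "one_positions n l \<subseteq> {1..n + k}"
    using one_positions_in_position_sets[OF assms(2)] by (simp add: position_sets_def)
  then have "adj_transp (n + k - j) ` (\<lambda>p. n + k + 1 - p) ` one_positions n l
      = (\<lambda>p. n + k + 1 - p) ` adj_transp j ` one_positions n l"
    unfolding image_image using refl by (intro image_cong) auto
  then show ?thesis
    using assms j' by (intro one_positions_inj[of _ n k])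
      (simp_all add: swap_letters dual_in_box one_positions_dual)
qed

lemma mem_one_positions_dual:
  assumes "p \<in> {1..n + k}" "l \<in> partitions_in_box n k"
  shows "p \<in> one_positions n (dual_partition k l) \<longleftrightarrow> n + k + 1 - p \<in> one_positions n l"
proof -
  have "one_positions n l \<subseteq> {1..n + k}"
    using one_positions_in_position_sets[OF assms(2)] by (simp add: position_sets_def)
  then show ?thesis unfolding one_positions_dual[OF assms(2)] using assms(1)
    by (force simp: image_iff)
qed

section \<open>The local operators on basis vectors\<close>

lemma delta_dual_apply:
  "delta_dual j f e = (if e j = 1 \<and> e (Suc j) = 0 then f (e \<circ> adj_transp j) else 0)"
proof -
  have "e(j := 0, Suc j := 1) = e \<circ> adj_transp j" if "e j = 1" "e (Suc j) = 0"
    using that by (auto simp: fun_eq_iff transpose_def)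
  then show ?thesis by (auto simp: delta_dual_def sigma_plus_def sigma_minus_def)
qed

lemma delta_apply:
  "delta j f e = (if e j = 0 \<and> e (Suc j) = 1 then f (e \<circ> adj_transp j) else 0)"
proof -
  have "e(j := 1, Suc j := 0) = e \<circ> adj_transp j" if "e j = 0" "e (Suc j) = 1"
    using that by (auto simp: fun_eq_iff transpose_def)
  then show ?thesis by (auto simp: delta_def sigma_plus_def sigma_minus_def)
qed

lemma comp_adj_eq_iff: "e \<circ> adj_transp j = e' \<longleftrightarrow> e = e' \<circ> adj_transp j"
  by (auto simp: fun_eq_iff) (metis transpose_involutory)+

lemma delta_dual_ket:
  "(delta_dual j (ket w) :: 'r::zero_neq_one tensor)
    = (if w j = 0 \<and> w (Suc j) = 1 then ket (w \<circ> adj_transp j) else (\<lambda>_. 0))"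
  by (rule ext) (auto simp: delta_dual_apply ket_def comp_adj_eq_iff)

lemma delta_ket:
  "(delta j (ket w) :: 'r::zero_neq_one tensor)
    = (if w j = 1 \<and> w (Suc j) = 0 then ket (w \<circ> adj_transp j) else (\<lambda>_. 0))"
  by (rule ext) (auto simp: delta_apply ket_def comp_adj_eq_iff)

lemma ket_nonzero: "(ket w :: 'r::zero_neq_one tensor) \<noteq> (\<lambda>_. 0)"
  by (metis ket_def zero_neq_one)

lemma ket_eq_iff: "(ket w :: 'r::zero_neq_one tensor) = ket w' \<longleftrightarrow> w = w'"
  by (metis ket_def zero_neq_one)

text \<open>
  Both \<open>delta j\<close> and \<open>delta_dual j\<close>, where they do not annihilate a basis vector, exchange two
  letters of its word; so one partition, that of the swapped word, serves for either.
\<close>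

lemma image_partition_eq_swap_letters:
  fixes D :: "'r::zero_neq_one tensor \<Rightarrow> 'r tensor"
  assumes "j \<in> {1..<n + k}" "l \<in> partitions_in_box n k"
    and "D (ket (word01 n k l)) = ket (word01 n k l \<circ> adj_transp j)"
  shows "image_partition n k D l = swap_letters n k j l"
  unfolding image_partition_def assms(3) ket_eq_iff
  by (rule the_equality)
    (use swap_letters[OF assms(1,2)] word01_swap_letters[OF assms(1,2)] word01_inj in metis)+

lemma delta_dual_ket_word01:
  assumes "j \<in> {1..<n + k}" "l \<in> partitions_in_box n k"
  shows "(delta_dual j (ket (word01 n k l)) :: 'r::zero_neq_one tensor) \<noteq> (\<lambda>_. 0)
      \<longleftrightarrow> j \<notin> one_positions n l \<and> Suc j \<in> one_positions n l" (is ?nz)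
    and "(delta_dual j (ket (word01 n k l)) :: 'r tensor) \<noteq> (\<lambda>_. 0)
      \<Longrightarrow> image_partition n k (delta_dual j :: 'r tensor \<Rightarrow> _) l = swap_letters n k j l"
proof -
  show ?nz using assms(1)
    by (auto simp: delta_dual_ket ket_nonzero word01_eq word_of_set_def)
  show "image_partition n k (delta_dual j :: 'r tensor \<Rightarrow> _) l = swap_letters n k j l"
    if "(delta_dual j (ket (word01 n k l)) :: 'r tensor) \<noteq> (\<lambda>_. 0)"
    by (rule image_partition_eq_swap_letters[OF assms])
      (use that in \<open>auto simp: delta_dual_ket split: if_splits\<close>)
qed

lemma delta_ket_word01:
  assumes "j \<in> {1..<n + k}" "l \<in> partitions_in_box n k"
  shows "(delta j (ket (word01 n k l)) :: 'r::zero_neq_one tensor) \<noteq> (\<lambda>_. 0)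
      \<longleftrightarrow> j \<in> one_positions n l \<and> Suc j \<notin> one_positions n l" (is ?nz)
    and "(delta j (ket (word01 n k l)) :: 'r tensor) \<noteq> (\<lambda>_. 0)
      \<Longrightarrow> image_partition n k (delta j :: 'r tensor \<Rightarrow> _) l = swap_letters n k j l"
proof -
  show ?nz using assms(1)
    by (auto simp: delta_ket ket_nonzero word01_eq word_of_set_def)
  show "image_partition n k (delta j :: 'r tensor \<Rightarrow> _) l = swap_letters n k j l"
    if "(delta j (ket (word01 n k l)) :: 'r tensor) \<noteq> (\<lambda>_. 0)"
    by (rule image_partition_eq_swap_letters[OF assms])
      (use that in \<open>auto simp: delta_ket split: if_splits\<close>)
qed

section \<open>Factorial powers under an exchange of parameters\<close>

lemma (in comm_ring_hom) hom_factorial_power: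
  "hom (factorial_power x a r) = factorial_power (hom x) (\<lambda>i. hom (a i)) r"
  by (simp add: factorial_power_def hom_distribs)

lemma factorial_power_cong:
  "(\<And>i. i \<in> {1..r} \<Longrightarrow> a i = b i) \<Longrightarrow> factorial_power x a r = factorial_power x b r"
  by (simp add: factorial_power_def)

lemma factorial_power_Suc: "factorial_power x a (Suc r) = factorial_power x a r * (x - a (Suc r))"
  by (simp add: factorial_power_def)

text \<open>
  For \<open>r < j\<close> the product involves neither parameter, and for \<open>r > j\<close> it involves both
  symmetrically. For \<open>r = j\<close> the identity is
  \<open>x - a_{j+1} = (x - a_j) + (a_j - a_{j+1})\<close>, multiplied by the remaining factors.
\<close>

lemma factorial_power_adj:
  assumes "j \<ge> 1"
  shows "factorial_power x (a \<circ> adj_transp j) r = factorial_power x a r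
    + (if r = j then (a j - a (Suc j)) * factorial_power x a (j - 1) else 0)"
proof -
  have below: "factorial_power x (a \<circ> adj_transp j) r = factorial_power x a r" if "r < j" for r
    using that by (intro factorial_power_cong) (auto simp: transpose_def)
  have at: "factorial_power x (a \<circ> adj_transp j) (j - 1) * (x - a (Suc j))
      = factorial_power x (a \<circ> adj_transp j) j"
    using factorial_power_Suc[of x "a \<circ> adj_transp j" "j - 1"] assms by simp
  have above: "factorial_power x (a \<circ> adj_transp j) r = factorial_power x a r" if "j < r"
    unfolding factorial_power_def o_def
    by (rule prod.reindex_bij_witness[of _ "adj_transp j" "adj_transp j"])
      (use that assms in \<open>auto simp: transpose_def\<close>)
  show ?thesis
  proof (cases r j rule: linorder_cases)
    case equal
    then show ?thesis
      using at below[of "j - 1"] factorial_power_Suc[of x a "j - 1"] assms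
      by (simp add: algebra_simps)
  qed (use below above in auto)
qed

section \<open>Alternants indexed by positions\<close>

text \<open>
  The row of position \<open>p\<close> carries the exponent \<open>p - 1\<close>, so that the exponents \<open>l_i + n - i\<close> of a
  factorial Schur function correspond to the positions of the letters 1 in the word of \<open>l\<close>.
\<close>

definition alternant :: "(nat \<Rightarrow> 'a::comm_ring_1) \<Rightarrow> nat list \<Rightarrow> 'a list \<Rightarrow> 'a" where
  "alternant a ps x = det (mat (length x) (length x)
     (\<lambda>(i, c). factorial_power (x ! c) a (ps ! i - 1)))"

lemma det_row_combination:
  fixes f g :: "nat \<Rightarrow> 'a::comm_ring_1"
  assumes "i\<^sub>0 < n"
  shows "det (mat n n (\<lambda>(i, c). if i = i\<^sub>0 then f c + b * g c else M i c))
    = det (mat n n (\<lambda>(i, c). if i = i\<^sub>0 then f c else M i c))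
    + b * det (mat n n (\<lambda>(i, c). if i = i\<^sub>0 then g c else M i c))"
proof -
  let ?A = "\<lambda>r. mat n n (\<lambda>(i, c). if i = i\<^sub>0 then r c else M i c)"
  have cof: "cofactor (?A r) i\<^sub>0 c = cofactor (?A f) i\<^sub>0 c" if "c < n" for r c
  proof -
    have "mat_delete (?A r) i\<^sub>0 c = mat_delete (?A f) i\<^sub>0 c"
      using that assms by (intro eq_matI) (auto simp: mat_delete_def)
    then show ?thesis by (simp add: cofactor_def)
  qed
  have expand: "det (?A r) = (\<Sum>c<n. r c * cofactor (?A f) i\<^sub>0 c)" for r
  proof -
    have "det (?A r) = (\<Sum>c<n. ?A r $$ (i\<^sub>0, c) * cofactor (?A r) i\<^sub>0 c)"
      by (rule laplace_expansion_row) (use assms in auto)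
    also have "\<dots> = (\<Sum>c<n. r c * cofactor (?A f) i\<^sub>0 c)"
      by (rule sum.cong[OF refl], subst cof) (use assms in auto)
    finally show ?thesis .
  qed
  show ?thesis unfolding expand by (simp add: sum.distrib sum_distrib_left algebra_simps)
qed

lemma alternant_eq_0_if_repeated:
  assumes "i < length x" "i' < length x" "i \<noteq> i'" "ps ! i = ps ! i'"
  shows "alternant a ps x = 0"
  unfolding alternant_def
  by (rule det_identical_rows[of _ "length x" i i']) (use assms in \<open>auto intro!: eq_vecI\<close>)

text \<open>
  A rearrangement of the variables permutes columns. It is essential that the sign does not depend on
  the list of positions: it is the same for numerator and denominator of a factorial Schur function.
\<close>

lemma alternant_mset_cong:
  assumes "mset x = mset x'"
  shows "\<exists>s\<in>{1, -1}. \<forall>ps. alternant a ps x = s * alternant a ps x'"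
proof -
  obtain p where p: "p permutes {..<length x'}" "permute_list p x' = x"
    using mset_eq_permutation[OF assms] .
  let ?n = "length x'"
  have len: "length x = ?n" using assms mset_eq_length by blast
  have p': "p permutes {0..<?n}" using p by (simp add: lessThan_atLeast0)
  have nth: "x ! c = x' ! p c" if "c < ?n" for c
    using permute_list_nth[OF p(1)] that p(2) by simp
  have pc: "p c < ?n" if "c < ?n" for c
    using permutes_in_image[OF p(1)] that by auto
  have "alternant a ps x = signof p * alternant a ps x'" for ps
  proof -
    let ?M = "\<lambda>x. mat ?n ?n (\<lambda>(c, i). factorial_power (x ! c) a (ps ! i - 1))"
    have tr: "alternant a ps x = det (?M x)" if "length x = ?n" for x
    proof -
      have "mat ?n ?n (\<lambda>(i, c). factorial_power (x ! c) a (ps ! i - 1)) = transpose_mat (?M x)"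
        by (intro eq_matI) auto
      then show ?thesis using that det_transpose[of "?M x" ?n] by (simp add: alternant_def)
    qed
    have "alternant a ps x = det (?M x)" by (rule tr[OF len])
    also have "?M x = mat ?n ?n (\<lambda>(c, i). ?M x' $$ (p c, i))"
      by (intro eq_matI) (auto simp: nth pc)
    also have "det \<dots> = signof p * det (?M x')"
      by (rule det_permute_rows[OF _ p']) simp
    also have "det (?M x') = alternant a ps x'" using tr[OF refl] by simp
    finally show ?thesis .
  qed
  then show ?thesis by (intro bexI[of _ "signof p"]) (auto simp: sign_def)
qed

lemma (in comm_ring_hom) hom_alternant:
  "hom (alternant a ps x) = alternant (\<lambda>i. hom (a i)) ps (map hom x)"
proof -
  have "map_mat hom (mat (length x) (length x) (\<lambda>(i, c). factorial_power (x ! c) a (ps ! i - 1)))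
    = mat (length x) (length x)
        (\<lambda>(i, c). factorial_power (map hom x ! c) (\<lambda>i. hom (a i)) (ps ! i - 1))"
    by (intro eq_matI) (auto simp: hom_factorial_power)
  then show ?thesis by (simp add: alternant_def flip: hom_det)
qed

lemma alternant_cong:
  assumes "set ps \<subseteq> {1..N}" "length x \<le> length ps" "\<And>i. i \<in> {1..N} \<Longrightarrow> a i = b i"
  shows "alternant a ps x = alternant b ps x"
proof -
  have "factorial_power z a (ps ! i - 1) = factorial_power z b (ps ! i - 1)" if "i < length x" for z i
  proof (rule factorial_power_cong)
    have "ps ! i \<in> {1..N}" using assms(1,2) that by (meson nth_mem order_less_le_trans subsetD)
    then show "a i' = b i'" if "i' \<in> {1..ps ! i - 1}" for i'
      using that by (intro assms(3)) auto
  qed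
  then show ?thesis unfolding alternant_def
    by (intro arg_cong[of _ _ det] eq_matI) auto
qed

text \<open>
  Only the row of position \<open>Suc j\<close>, with exponent \<open>j\<close>, feels the exchange. By linearity in that
  row the correction is a determinant with this row replaced by that of position \<open>j\<close>; if \<open>j\<close> occurs
  already, two of its rows agree.
\<close>

lemma alternant_adj:
  fixes a :: "nat \<Rightarrow> 'a::comm_ring_1"
  assumes "j \<ge> 1" "distinct ps" "0 \<notin> set ps" "length ps = length x"
  shows "alternant (a \<circ> adj_transp j) ps x = alternant a ps x
    + (if Suc j \<in> set ps \<and> j \<notin> set ps
       then (a j - a (Suc j)) * alternant a (map (adj_transp j) ps) x else 0)"
proof (cases "Suc j \<in> set ps")
  case False
  have "ps ! i - 1 \<noteq> j" if "i < length x" for i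
    using that False assms(3,4) by (metis One_nat_def Suc_pred nth_mem neq0_conv)
  then have "factorial_power (x ! c) (a \<circ> adj_transp j) (ps ! i - 1) = factorial_power (x ! c) a (ps ! i - 1)"
    if "i < length x" for i c
    using that by (simp add: factorial_power_adj[OF assms(1)])
  then have "alternant (a \<circ> adj_transp j) ps x = alternant a ps x"
    unfolding alternant_def by (intro arg_cong[of _ _ det] eq_matI) auto
  then show ?thesis using False by simp
next
  case True
  let ?n = "length x"
  obtain i\<^sub>0 where i\<^sub>0: "i\<^sub>0 < ?n" "ps ! i\<^sub>0 = Suc j"
    using True assms(4) by (metis in_set_conv_nth)
  have other: "ps ! i \<noteq> Suc j" if "i < ?n" "i \<noteq> i\<^sub>0" for i
    using that i\<^sub>0 assms(2,4) by (metis nth_eq_iff_index_eq)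
  let ?M = "\<lambda>i c. factorial_power (x ! c) a (ps ! i - 1)"
  have "ps ! i - 1 \<noteq> j" if "i < ?n" "i \<noteq> i\<^sub>0" for i
    using other[OF that] that assms(3,4) by (metis One_nat_def Suc_pred nth_mem neq0_conv)
  then have "factorial_power (x ! c) (a \<circ> adj_transp j) (ps ! i - 1) = ?M i c" if "i < ?n" "i \<noteq> i\<^sub>0" for i c
    using that by (simp add: factorial_power_adj[OF assms(1)])
  then have "alternant (a \<circ> adj_transp j) ps x
    = det (mat ?n ?n (\<lambda>(i, c). if i = i\<^sub>0 then factorial_power (x ! c) a j
        + (a j - a (Suc j)) * factorial_power (x ! c) a (j - 1) else ?M i c))"
    unfolding alternant_def using i\<^sub>0
    by (intro arg_cong[of _ _ det] eq_matI) (auto simp: factorial_power_adj[OF assms(1)])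
  also have "\<dots> = det (mat ?n ?n (\<lambda>(i, c). if i = i\<^sub>0 then factorial_power (x ! c) a j else ?M i c))
      + (a j - a (Suc j)) * det (mat ?n ?n
          (\<lambda>(i, c). if i = i\<^sub>0 then factorial_power (x ! c) a (j - 1) else ?M i c))"
    by (rule det_row_combination[OF i\<^sub>0(1)])
  also have "det (mat ?n ?n (\<lambda>(i, c). if i = i\<^sub>0 then factorial_power (x ! c) a j else ?M i c))
      = alternant a ps x"
    unfolding alternant_def using i\<^sub>0 by (intro arg_cong[of _ _ det] eq_matI) auto
  also have "mat ?n ?n (\<lambda>(i, c). if i = i\<^sub>0 then factorial_power (x ! c) a (j - 1) else ?M i c)
      = mat ?n ?n (\<lambda>(i, c). factorial_power (x ! c) a (ps[i\<^sub>0 := j] ! i - 1))"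
    using i\<^sub>0 assms(4) by (intro eq_matI) auto
  finally have eq: "alternant (a \<circ> adj_transp j) ps x
      = alternant a ps x + (a j - a (Suc j)) * alternant a (ps[i\<^sub>0 := j]) x"
    by (simp add: alternant_def o_def)
  show ?thesis
  proof (cases "j \<in> set ps")
    case True
    then obtain i where i: "i < ?n" "ps ! i = j" using assms(4) by (metis in_set_conv_nth)
    then have "alternant a (ps[i\<^sub>0 := j]) x = 0"
      using i\<^sub>0 assms(4) by (intro alternant_eq_0_if_repeated[of i\<^sub>0 _ i]) (auto simp: nth_list_update)
    then show ?thesis using eq True by simp
  next
    case False
    have "map (adj_transp j) ps = ps[i\<^sub>0 := j]"
    proof (rule nth_equalityI)
      fix i assume "i < length (map (adj_transp j) ps)"
      then show "map (adj_transp j) ps ! i = ps[i\<^sub>0 := j] ! i"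
        using other[of i] i\<^sub>0 False assms(4) by (auto simp: nth_list_update transpose_def in_set_conv_nth)
    qed simp
    then show ?thesis using eq True False by simp
  qed
qed

text \<open>
  Parts of a partition decrease, hence so do the exponents in the rows of a factorial Schur
  function.
\<close>

definition descending :: "nat set \<Rightarrow> nat list" where
  "descending S = rev (sorted_list_of_set S)"

lemma descending_simps [simp]:
  "finite S \<Longrightarrow> set (descending S) = S" "distinct (descending S)" "length (descending S) = card S"
  by (simp_all add: descending_def)

text \<open>
  Replacing \<open>Suc j\<close> by \<open>j\<close> in a set without \<open>j\<close> does not affect the order of the elements, so that
  no sign arises.
\<close>

lemma descending_adj_image:
  assumes "finite S" "Suc j \<in> S" "j \<notin> S"
  shows "descending (adj_transp j ` S) = map (adj_transp j) (descending S)"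
proof -
  have "sorted_wrt (<) (map (adj_transp j) (sorted_list_of_set S))"
    unfolding sorted_wrt_map
    by (rule sorted_wrt_mono_rel[OF _ strict_sorted_list_of_set]) (use assms in \<open>auto simp: transpose_def\<close>)
  moreover have "set (map (adj_transp j) (sorted_list_of_set S)) = adj_transp j ` S" using assms by simp
  ultimately have "sorted_list_of_set (adj_transp j ` S) = map (adj_transp j) (sorted_list_of_set S)"
    using sorted_list_of_set.idem_if_sorted_distinct[of "map (adj_transp j) (sorted_list_of_set S)"]
    unfolding strict_sorted_iff by simp
  then show ?thesis by (simp only: descending_def rev_map)
qed

lemma hom_alternant_adj:
  fixes h :: "'a::comm_ring_1 \<Rightarrow> 'a"
  assumes "comm_ring_hom h" "j \<in> {1..<N}" "\<And>i. i \<in> {1..N} \<Longrightarrow> h (a i) = a (adj_transp j i)"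
    and "S \<in> position_sets n N" "length x = n"
  shows "h (alternant a (descending S) x) = alternant a (descending S) (map h x)
    + (if Suc j \<in> S \<and> j \<notin> S
       then (a j - a (Suc j)) * alternant a (descending (adj_transp j ` S)) (map h x) else 0)"
proof -
  have S: "finite S" "S \<subseteq> {1..N}" "card S = n"
    using assms(4) position_sets_finite[OF assms(4)] by (auto simp: position_sets_def)
  have "h (alternant a (descending S) x) = alternant (\<lambda>i. h (a i)) (descending S) (map h x)"
    by (rule comm_ring_hom.hom_alternant[OF assms(1)])
  also have "\<dots> = alternant (a \<circ> adj_transp j) (descending S) (map h x)"
  proof (rule alternant_cong[of _ N])
    show "h (a i) = (a \<circ> adj_transp j) i" if "i \<in> {1..N}" for i
      using assms(3)[OF that] by simp
  qed (use S assms(5) in simp_all)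
  also have "\<dots> = alternant a (descending S) (map h x)
    + (if Suc j \<in> S \<and> j \<notin> S
       then (a j - a (Suc j)) * alternant a (descending (adj_transp j ` S)) (map h x) else 0)"
  proof -
    have "j \<ge> 1" "0 \<notin> S" using S(2) assms(2) by auto
    then have "alternant (a \<circ> adj_transp j) (descending S) (map h x) = alternant a (descending S) (map h x)
      + (if Suc j \<in> S \<and> j \<notin> S
         then (a j - a (Suc j)) * alternant a (map (adj_transp j) (descending S)) (map h x) else 0)"
      using S assms(5) alternant_adj[of j "descending S" "map h x" a] by simp
    then show ?thesis
      by (cases "Suc j \<in> S \<and> j \<notin> S") (auto simp: descending_adj_image[OF S(1)])
  qed
  finally show ?thesis .
qed

section \<open>The exchange formula for factorial Schur functions\<close>

lemma factorial_schur_eq_alternant: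
  assumes "l \<in> partitions_in_box n k" "length x = n"
  shows "factorial_schur l x a
    = alternant a (descending (one_positions n l)) x / alternant a (descending {1..n}) x"
proof -
  have num: "descending (one_positions n l) ! i - 1 = l ! i + (n - Suc i)" if "i < n" for i
    using that by (simp add: descending_def sorted_list_of_one_positions[OF assms(1)] rev_nth del: upt_Suc)
  have "sorted_list_of_set {1..n} = [1..<Suc n]"
    by (metis atLeastLessThanSuc_atLeastAtMost sorted_list_of_set_range)
  then have den: "descending {1..n} ! i - 1 = n - Suc i" if "i < n" for i
    using that by (simp add: descending_def rev_nth del: upt_Suc)
  show ?thesis
    unfolding factorial_schur_def alternant_def Let_def assms(2)
    by (intro arg_cong2[of _ _ _ _ "(/)"] arg_cong[of _ _ det] eq_matI) (use num den in auto)
qed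

lemma factorial_schur_mset_cong:
  assumes "l \<in> partitions_in_box n k" "length x = n" "mset x = mset x'"
  shows "factorial_schur l x a = factorial_schur l x' a"
proof -
  obtain s where "s \<in> {1, -1}" "\<forall>ps. alternant a ps x = s * alternant a ps x'"
    using alternant_mset_cong[OF assms(3)] by blast
  moreover have "length x' = n" using assms mset_eq_length by metis
  ultimately show ?thesis
    unfolding factorial_schur_eq_alternant[OF assms(1,2)]
      factorial_schur_eq_alternant[OF assms(1) \<open>length x' = n\<close>]
    by (elim insertE emptyE) simp_all
qed

text \<open>
  The denominator is invariant up to \<open>h\<close> acting on the variables, as \<open>Suc j \<in> {1..n}\<close> implies
  \<open>j \<in> {1..n}\<close>. Since division by 0 yields 0, both sides are 0 when the denominator vanishes.
\<close>

lemma hom_factorial_schur: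
  fixes h :: "'a::field \<Rightarrow> 'a"
  assumes "field_hom h" "j \<in> {1..<n + k}" "\<And>i. i \<in> {1..n + k} \<Longrightarrow> h (a i) = a (adj_transp j i)"
    and "l \<in> partitions_in_box n k" "length x = n"
  shows "h (factorial_schur l x a) = factorial_schur l (map h x) a
    + (if Suc j \<in> one_positions n l \<and> j \<notin> one_positions n l
       then (a j - a (Suc j)) * factorial_schur (swap_letters n k j l) (map h x) a else 0)"
proof -
  interpret field_hom h by fact
  note exchange = hom_alternant_adj[where a = a and h = h and j = j and N = "n + k" and n = n and x = x,
      OF comm_ring_hom_axioms assms(2) _ _ assms(5)]
  have "{1..n} \<in> position_sets n (n + k)" by (simp add: position_sets_def)
  then have "h (alternant a (descending {1..n}) x) = alternant a (descending {1..n}) (map h x)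
    + (if Suc j \<in> {1..n} \<and> j \<notin> {1..n}
       then (a j - a (Suc j)) * alternant a (descending (adj_transp j ` {1..n})) (map h x) else 0)"
    by (intro exchange assms(3))
  moreover have "\<not> (Suc j \<in> {1..n} \<and> j \<notin> {1..n})" using assms(2) by auto
  ultimately have den: "h (alternant a (descending {1..n}) x) = alternant a (descending {1..n}) (map h x)"
    by (simp only: if_False add_0_right)
  have num: "h (alternant a (descending (one_positions n l)) x)
    = alternant a (descending (one_positions n l)) (map h x)
    + (if Suc j \<in> one_positions n l \<and> j \<notin> one_positions n l
       then (a j - a (Suc j)) * alternant a (descending (adj_transp j ` one_positions n l)) (map h x) else 0)"
    by (intro exchange assms(3) one_positions_in_position_sets[OF assms(4)])
  have len: "length (map h x) = n" using assms(5) by simp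
  note quotient = factorial_schur_eq_alternant[OF assms(4,5)] factorial_schur_eq_alternant[OF assms(4) len]
    factorial_schur_eq_alternant[OF swap_letters(1)[OF assms(2,4)] len]
  show ?thesis
    unfolding quotient swap_letters(2)[OF assms(2,4)] divide_inverse hom_mult hom_inverse num den
    by (auto simp only: if_True if_False distrib_right mult.assoc add_0_right mult_zero_left split: if_split)
qed

section \<open>Field homomorphisms acting on coefficients of Laurent series\<close>

lemma fls_map_coeffs_nth:
  assumes "g 0 = 0"
  shows "fls_nth (fls_map_coeffs g f) m = g (fls_nth f m)"
proof -
  have "\<forall>m<fls_subdegree f. g (fls_nth f m) = 0"
    using assms by simp
  then show ?thesis unfolding fls_map_coeffs_def
    by (rule nth_Abs_fls_lower_bound)
qed

lemma fls_subdegree_map_coeffs: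
  assumes "field_hom g"
  shows "fls_subdegree (fls_map_coeffs g f) = fls_subdegree f"
proof (cases "f = 0")
  case False
  interpret field_hom g by fact
  show ?thesis
    by (rule fls_subdegree_eqI)
      (use False in \<open>simp_all add: fls_map_coeffs_nth nth_fls_subdegree_nonzero\<close>)
next
  case True
  interpret field_hom g by fact
  have "fls_map_coeffs g f = 0" by (rule fls_eqI) (simp add: True fls_map_coeffs_nth)
  then show ?thesis by (simp add: True)
qed

text \<open>
  The coefficients of a product are finite sums whose range depends on the subdegrees of the factors,
  and an injective map preserves these.
\<close>

lemma field_hom_fls_map_coeffs:
  assumes "field_hom g"
  shows "field_hom (fls_map_coeffs g)"
proof -
  interpret g: field_hom g by fact
  note nth = fls_map_coeffs_nth[of g, OF g.hom_zero]
  show ?thesis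
  proof unfold_locales
    show "fls_map_coeffs g 0 = 0" "fls_map_coeffs g 1 = 1"
      by (rule fls_eqI, simp add: nth)+
    show "fls_map_coeffs g (a + b) = fls_map_coeffs g a + fls_map_coeffs g b" for a b
      by (rule fls_eqI) (simp add: nth g.hom_add)
    show "fls_map_coeffs g (a * b) = fls_map_coeffs g a * fls_map_coeffs g b" for a b
      by (rule fls_eqI)
        (simp add: nth fls_times_nth(2) fls_subdegree_map_coeffs[OF assms] g.hom_sum g.hom_mult)
  qed
qed

lemma fls_map_coeffs_const: "g 0 = 0 \<Longrightarrow> fls_map_coeffs g (fls_const c) = fls_const (g c)"
  by (rule fls_eqI) (simp add: fls_map_coeffs_nth)

lemma fls_map_coeffs_X:
  assumes "field_hom g"
  shows "fls_map_coeffs g fls_X = fls_X"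
proof -
  interpret field_hom g by fact
  show ?thesis by (rule fls_eqI) (simp add: fls_map_coeffs_nth)
qed

section \<open>The action on Bethe roots\<close>

text \<open>
  Two equal parameters would satisfy the polynomial relation \<open>T_a - T_b = 0\<close>.
\<close>

lemma alg_independent_inj:
  fixes \<iota> :: "complex \<Rightarrow> 'k::field"
  assumes "field_hom \<iota>" "alg_independent \<iota> N T"
  shows "inj_on T {1..N}"
proof (rule inj_onI, rule ccontr)
  interpret field_hom \<iota> by fact
  fix a b assume ab: "a \<in> {1..N}" "b \<in> {1..N}" "T a = T b" "a \<noteq> b"
  define m where "m = (\<lambda>a. \<lambda>i\<in>{1..N}. if i = a then 1 else 0 :: nat)"
  have ne: "m a \<noteq> m b"
  proof
    assume "m a = m b"
    then have "m a a = m b a" by simp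
    then show False using ab by (simp add: m_def)
  qed
  have mono: "(\<Prod>i=1..N. T i ^ m c i) = T c" if "c \<in> {1..N}" for c
  proof -
    have "(\<Prod>i=1..N. T i ^ m c i) = (\<Prod>i=1..N. if i = c then T c else 1)"
      by (rule prod.cong) (auto simp: m_def)
    then show ?thesis using that by simp
  qed
  \<comment> \<open>The coefficients of the relation \<open>T a - T b = 0\<close>, for the exponent vectors \<open>m a\<close> and \<open>m b\<close>.\<close>
  define c where "c = (\<lambda>e. if e = m a then 1 else - 1 :: complex)"
  have "(\<Sum>e\<in>{m a, m b}. \<iota> (c e) * (\<Prod>i=1..N. T i ^ e i)) = 0"
    using ne ab mono[of a] mono[of b] by (simp add: c_def hom_distribs)
  moreover have "{m a, m b} \<subseteq> {1..N} \<rightarrow>\<^sub>E UNIV" by (auto simp: m_def)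
  ultimately have "finite {m a, m b} \<and> {m a, m b} \<subseteq> {1..N} \<rightarrow>\<^sub>E UNIV
      \<and> (\<Sum>e\<in>{m a, m b}. \<iota> (c e) * (\<Prod>i=1..N. T i ^ e i)) = 0"
    by simp
  then have "\<forall>e\<in>{m a, m b}. c e = 0"
    by (rule assms(2)[unfolded alg_independent_def, THEN spec, THEN spec, THEN mp])
  then have "c (m a) = 0" by simp
  then show False by (simp add: c_def)
qed

text \<open>
  The image of a root solves the same equation, because the equation is symmetric in the parameters.
  So it is one of the roots, and its constant term tells which one.
\<close>

lemma fls_map_coeffs_bethe_root:
  fixes t :: "nat \<Rightarrow> 'k::field"
  assumes "field_hom g" "j \<in> {1..<N}" "\<And>i. i \<in> {1..N} \<Longrightarrow> g (t i) = t (adj_transp j i)"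
    and "inj_on t {1..N}" "bethe_roots n N t y" "i \<in> {1..N}"
  shows "fls_map_coeffs g (y i) = y (adj_transp j i)"
proof -
  interpret g: field_hom g by fact
  interpret field_hom "fls_map_coeffs g" by (rule field_hom_fls_map_coeffs) fact
  have roots: "{z. (\<Prod>j=1..N. z - fls_const (t j)) + (- 1) ^ n * fls_X ^ N = 0} = y ` {1..N}"
    and y0: "\<And>j. j \<in> {1..N} \<Longrightarrow> fls_nth (y j) 0 = t j"
    using assms(5) by (auto simp: bethe_roots_def)
  let ?z = "fls_map_coeffs g (y i)"
  have "(\<Prod>j=1..N. y i - fls_const (t j)) + (- 1) ^ n * fls_X ^ N = 0"
    using roots assms(6) by blast
  then have "fls_map_coeffs g ((\<Prod>j=1..N. y i - fls_const (t j)) + (- 1) ^ n * fls_X ^ N) = 0"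
    by simp
  then have "(\<Prod>m=1..N. ?z - fls_const (g (t m))) + (- 1) ^ n * fls_X ^ N = 0"
    by (simp add: hom_distribs fls_map_coeffs_const fls_map_coeffs_X[OF assms(1)])
  also have "(\<Prod>m=1..N. ?z - fls_const (g (t m))) = (\<Prod>m=1..N. ?z - fls_const (t (adj_transp j m)))"
    using assms(3) by (intro prod.cong) auto
  also have "\<dots> = (\<Prod>m=1..N. ?z - fls_const (t m))"
    by (rule prod.reindex_bij_witness[of _ "adj_transp j" "adj_transp j"])
      (use adj_mem_iff[OF assms(2)] in auto)
  finally obtain m where m: "m \<in> {1..N}" "?z = y m" using roots by blast
  have "t m = fls_nth ?z 0" using m y0 by simp
  also have "\<dots> = t (adj_transp j i)" using assms(3,6) y0 by (simp add: fls_map_coeffs_nth)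
  finally have "m = adj_transp j i"
    using assms(4) m(1) adj_mem_iff[OF assms(2), of i] assms(6) by (auto dest: inj_onD)
  then show ?thesis using m by simp
qed

lemma length_root_tuple:
  "\<alpha> \<in> partitions_in_box n k \<Longrightarrow> length (root_tuple n y \<alpha>) = n"
  by (simp add: root_tuple_def sorted_list_of_one_positions)

lemma mset_map_root_tuple:
  assumes "j \<in> {1..<n + k}" "\<alpha> \<in> partitions_in_box n k"
    and "\<And>i. i \<in> {1..n + k} \<Longrightarrow> h (y i) = y (adj_transp j i)"
  shows "mset (map h (root_tuple n y \<alpha>)) = mset (root_tuple n y (swap_letters n k j \<alpha>))"
proof -
  let ?S = "one_positions n \<alpha>"
  have S: "finite ?S" "?S \<subseteq> {1..n + k}"
    using one_positions_in_position_sets[OF assms(2)] position_sets_finite[OF one_positions_in_position_sets[OF assms(2)]]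
    by (simp_all add: position_sets_def)
  have mset: "mset (sorted_list_of_set A) = mset_set A" for A :: "nat set"
    by (metis mset_sorted_list_of_multiset sorted_list_of_mset_set)
  have "mset (map h (root_tuple n y \<alpha>)) = image_mset (\<lambda>i. h (y i)) (mset_set ?S)"
    by (simp add: root_tuple_def mset multiset.map_comp o_def)
  also have "\<dots> = image_mset (\<lambda>i. y (adj_transp j i)) (mset_set ?S)"
    using S assms(3) by (intro image_mset_cong) auto
  also have "\<dots> = image_mset y (image_mset (adj_transp j) (mset_set ?S))"
    by (simp add: multiset.map_comp o_def)
  also have "image_mset (adj_transp j) (mset_set ?S) = mset_set (adj_transp j ` ?S)"
    by (rule image_mset_mset_set) (rule inj_on_subset[OF inj_transpose], simp)
  also have "image_mset y (mset_set (adj_transp j ` ?S)) = mset (root_tuple n y (swap_letters n k j \<alpha>))"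
    by (simp add: root_tuple_def mset swap_letters(2)[OF assms(1,2)])
  finally show ?thesis .
qed

text \<open>
  The exchange of parameters and the exchange of roots are indexed separately: for the parameters
  \<open>a = t\<close> the two indices agree, while for the reversed parameters \<open>a = T\<close> they are \<open>n + k - j\<close> and \<open>j\<close>.
\<close>

lemma hom_schur_at_roots:
  fixes h :: "'a::field \<Rightarrow> 'a"
  assumes "field_hom h" "j' \<in> {1..<n + k}" "\<And>i. i \<in> {1..n + k} \<Longrightarrow> h (a i) = a (adj_transp j' i)"
    and "j \<in> {1..<n + k}" "\<And>i. i \<in> {1..n + k} \<Longrightarrow> h (y i) = y (adj_transp j i)"
    and "l \<in> partitions_in_box n k" "\<alpha> \<in> partitions_in_box n k"
  shows "h (factorial_schur l (root_tuple n y \<alpha>) a)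
    = factorial_schur l (root_tuple n y (swap_letters n k j \<alpha>)) a
    + (if Suc j' \<in> one_positions n l \<and> j' \<notin> one_positions n l
       then (a j' - a (Suc j')) * factorial_schur (swap_letters n k j' l)
              (root_tuple n y (swap_letters n k j \<alpha>)) a else 0)"
proof -
  have len: "length (map h (root_tuple n y \<alpha>)) = n"
    using length_root_tuple[OF assms(7)] by simp
  have mset: "mset (map h (root_tuple n y \<alpha>)) = mset (root_tuple n y (swap_letters n k j \<alpha>))"
    by (intro mset_map_root_tuple assms)
  note sym = factorial_schur_mset_cong[OF _ len mset, where a = a]
  show ?thesis
    using hom_factorial_schur[OF assms(1,2) _ assms(6) length_root_tuple[OF assms(7)], of a y] assms(3)
    unfolding sym[OF assms(6)] sym[OF swap_letters(1)[OF assms(2,6)]] by blast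
qed

section \<open>Linear functionals dual to the factorial powers\<close>

text \<open>
  The products are monic of distinct degrees.
\<close>

lemma poly_prod_linear_coeffs_zero:
  fixes c :: "nat \<Rightarrow> 'a::field" and a :: "nat \<Rightarrow> 'a"
  assumes "(\<Sum>r<N. Polynomial.smult (c r) (\<Prod>i=1..r. [:- a i, 1:])) = 0" "r < N"
  shows "c r = 0"
  using assms
proof (induction N)
  case (Suc N)
  let ?p = "\<lambda>r. \<Prod>i=1..r. [:- a i, 1:]"
  have deg: "degree (?p r) = r" for r
    by (subst degree_prod_eq_sum_degree) auto
  have lead: "coeff (?p N) N = 1"
    using lead_coeff_prod[of "\<lambda>i. [:- a i, 1:]" "{1..N}"] deg[of N] by simp
  have "coeff (\<Sum>r<Suc N. Polynomial.smult (c r) (?p r)) N = (\<Sum>r<N. c r * coeff (?p r) N) + c N"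
    by (simp add: coeff_sum lead del: One_nat_def)
  also have "(\<Sum>r<N. c r * coeff (?p r) N) = 0"
    by (rule sum.neutral) (simp add: coeff_eq_0 deg del: One_nat_def)
  finally have cN: "c N = 0" using Suc.prems(1) by (simp only: coeff_0 add_0_left)
  then have "(\<Sum>r<N. Polynomial.smult (c r) (?p r)) = 0"
    using Suc.prems(1) by (simp del: One_nat_def)
  then show ?case using Suc.IH Suc.prems(2) cN by (cases "r = N") auto
qed simp

text \<open>
  A linear dependence between the columns of the matrix of values would be a polynomial of degree
  less than \<open>N\<close> with the \<open>N\<close> roots \<open>0, ..., N - 1\<close>; so the matrix is invertible, and the rows of its
  inverse are the weights of the functionals.
\<close>

lemma dual_functionals_factorial_powers:
  fixes a :: "nat \<Rightarrow> 'a::field"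
  assumes inj: "inj (of_nat :: nat \<Rightarrow> 'a)"
  obtains w where "\<And>p p'. p \<in> {1..N} \<Longrightarrow> p' \<in> {1..N} \<Longrightarrow>
    (\<Sum>m<N. w p m * factorial_power (of_nat m) a (p' - 1)) = (if p = p' then 1 else 0)"
proof -
  define A where "A = mat N N (\<lambda>(m, r). factorial_power (of_nat m :: 'a) a r)"
  have A: "A \<in> carrier_mat N N" by (simp add: A_def)
  have "det A \<noteq> 0"
  proof
    assume "det A = 0"
    then obtain v where v: "v \<in> carrier_vec N" "v \<noteq> 0\<^sub>v N" "A *\<^sub>v v = 0\<^sub>v N"
      using det_0_iff_vec_prod_zero[OF A] by blast
    define P where "P = (\<Sum>r<N. Polynomial.smult (v $ r) (\<Prod>i=1..r. [:- a i, 1:]))"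
    have eval: "poly P x = (\<Sum>r<N. factorial_power x a r * v $ r)" for x
      by (simp add: P_def poly_sum poly_prod factorial_power_def mult.commute)
    have zero: "poly P (of_nat m) = 0" if "m < N" for m
    proof -
      have "(A *\<^sub>v v) $ m = (\<Sum>r<N. factorial_power (of_nat m) a r * v $ r)"
        using that v(1) by (simp add: A_def scalar_prod_def lessThan_atLeast0)
      then show ?thesis using v(3) that eval by simp
    qed
    have "P = 0"
    proof (rule ccontr)
      assume "P \<noteq> 0"
      have "N > 0" using v(1,2) by (cases N) auto
      have "degree P \<le> N - 1" unfolding P_def
      proof (rule degree_sum_le)
        fix r assume r: "r \<in> {..<N}"
        have "degree (\<Prod>i=1..r. [:- a i, 1:]) = r"
          by (subst degree_prod_eq_sum_degree) auto
        then show "degree (Polynomial.smult (v $ r) (\<Prod>i=1..r. [:- a i, 1:])) \<le> N - 1"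
          using r degree_smult_le[of "v $ r" "\<Prod>i=1..r. [:- a i, 1:]"] by simp
      qed simp
      moreover have "card (of_nat ` {..<N} :: 'a set) \<le> card {x. poly P x = 0}"
        using zero poly_roots_finite[OF \<open>P \<noteq> 0\<close>] by (intro card_mono) auto
      moreover have "card (of_nat ` {..<N} :: 'a set) = N"
        using inj by (simp add: card_image inj_on_subset)
      ultimately show False
        using card_poly_roots_bound[OF \<open>P \<noteq> 0\<close>] \<open>N > 0\<close> by linarith
    qed
    then have "v $ r = 0" if "r < N" for r
      using poly_prod_linear_coeffs_zero[where c = "\<lambda>r. v $ r" and a = a and N = N] that by (simp add: P_def)
    then have "v = 0\<^sub>v N" using v(1) by (intro eq_vecI) auto
    then show False using v(2) by simp
  qed
  \<comment> \<open>The adjugate divided by the determinant is the inverse of \<open>A\<close>.\<close>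
  define w where "w = (\<lambda>p m. adj_mat A $$ (p - 1, m) / det A)"
  have "(\<Sum>m<N. w p m * factorial_power (of_nat m) a (p' - 1)) = (if p = p' then 1 else 0)"
    if p: "p \<in> {1..N}" "p' \<in> {1..N}" for p p'
  proof -
    have lt: "p - 1 < N" "p' - 1 < N" using p by auto
    have "(adj_mat A * A) $$ (p - 1, p' - 1) = (\<Sum>m<N. adj_mat A $$ (p - 1, m) * A $$ (m, p' - 1))"
      using lt A adj_mat(1)[OF A] by (simp add: scalar_prod_def lessThan_atLeast0)
    also have "\<dots> = (\<Sum>m<N. w p m * factorial_power (of_nat m) a (p' - 1)) * det A"
      using \<open>det A \<noteq> 0\<close> lt unfolding sum_distrib_right
      by (intro sum.cong) (auto simp: w_def A_def)
    also have "(adj_mat A * A) $$ (p - 1, p' - 1) = (if p - 1 = p' - 1 then det A else 0)"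
      unfolding adj_mat(3)[OF A] using lt by simp
    finally have "(\<Sum>m<N. w p m * factorial_power (of_nat m) a (p' - 1)) * det A
        = (if p - 1 = p' - 1 then det A else 0)" by (rule sym)
    moreover have "p - 1 = p' - 1 \<longleftrightarrow> p = p'" using p by auto
    ultimately show ?thesis using \<open>det A \<noteq> 0\<close> by (simp split: if_splits)
  qed
  then show ?thesis by (rule that)
qed

section \<open>A faithful pairing of vectors with alternants\<close>

text \<open>
  A determinant is linear in each of its columns; here every column is expanded.
\<close>

lemma det_sum_columns:
  fixes B :: "nat \<Rightarrow> 'b \<Rightarrow> 'a::comm_ring_1"
  assumes "finite M"
  shows "det (mat n n (\<lambda>(i, c). \<Sum>m\<in>M. w c m * B i m))
    = (\<Sum>g\<in>{..<n} \<rightarrow>\<^sub>E M. (\<Prod>c<n. w c (g c)) * det (mat n n (\<lambda>(i, c). B i (g c))))"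
proof -
  let ?P = "{p. p permutes {0..<n}}"
  have lt: "p c < n" if "p \<in> ?P" "c < n" for p c
    using that permutes_in_image[of p "{0..<n}" c] by auto
  have "det (mat n n (\<lambda>(i, c). \<Sum>m\<in>M. w c m * B i m))
      = (\<Sum>p\<in>?P. signof p * (\<Prod>c<n. \<Sum>m\<in>M. w c m * B (p c) m))"
    by (subst det_col[of _ n]) (auto simp: lt intro!: sum.cong prod.cong arg_cong2[of _ _ _ _ "(*)"])
  also have "\<dots> = (\<Sum>p\<in>?P. \<Sum>g\<in>{..<n} \<rightarrow>\<^sub>E M.
      signof p * ((\<Prod>c<n. w c (g c)) * (\<Prod>c<n. B (p c) (g c))))"
    using assms by (simp add: prod_sum_PiE prod.distrib sum_distrib_left)
  also have "\<dots> = (\<Sum>g\<in>{..<n} \<rightarrow>\<^sub>E M. \<Sum>p\<in>?P.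
      signof p * ((\<Prod>c<n. w c (g c)) * (\<Prod>c<n. B (p c) (g c))))"
    by (rule sum.swap)
  also have "\<dots> = (\<Sum>g\<in>{..<n} \<rightarrow>\<^sub>E M. (\<Prod>c<n. w c (g c))
      * (\<Sum>p\<in>?P. signof p * (\<Prod>c<n. B (p c) (g c))))"
    by (simp add: sum_distrib_left mult.left_commute)
  also have "\<dots> = (\<Sum>g\<in>{..<n} \<rightarrow>\<^sub>E M. (\<Prod>c<n. w c (g c)) * det (mat n n (\<lambda>(i, c). B i (g c))))"
    by (intro sum.cong refl arg_cong2[of _ _ _ _ "(*)"], subst det_col[of _ n])
      (auto simp: lt intro!: sum.cong prod.cong arg_cong2[of _ _ _ _ "(*)"])
  finally show ?thesis .
qed

text \<open>
  This interprets the basis vector of a word as an antisymmetric polynomial in \<open>n\<close> variables, of degree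
  less than \<open>N\<close> in each of them.
\<close>

definition alternant_pairing ::
  "(nat \<Rightarrow> 'r::comm_ring_1) \<Rightarrow> nat \<Rightarrow> nat \<Rightarrow> 'r tensor \<Rightarrow> 'r list \<Rightarrow> 'r" where
  "alternant_pairing t n N v x =
     (\<Sum>S\<in>position_sets n N. v (word_of_set N S) * alternant t (descending S) x)"

text \<open>
  Applying in each variable the functional dual to one of the positions in \<open>S\<^sub>0\<close> turns the alternant of
  \<open>S\<close> into a determinant of Kronecker symbols. It is 1 for \<open>S = S\<^sub>0\<close>; for any other \<open>S\<close> of the same size
  some position is missing from \<open>S\<^sub>0\<close>, and its row vanishes. This recovers the coefficient at \<open>S\<^sub>0\<close>.
\<close>

lemma alternant_pairing_faithful:
  fixes t :: "nat \<Rightarrow> 'a::field"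
  assumes inj: "inj (of_nat :: nat \<Rightarrow> 'a)"
    and eq: "\<And>x. length x = n \<Longrightarrow>
      alternant_pairing t n N v (map of_nat x) = alternant_pairing t n N v' (map of_nat x)"
    and S\<^sub>0: "S\<^sub>0 \<in> position_sets n N"
  shows "v (word_of_set N S\<^sub>0) = v' (word_of_set N S\<^sub>0)"
proof -
  obtain w where w: "\<And>p p'. p \<in> {1..N} \<Longrightarrow> p' \<in> {1..N} \<Longrightarrow>
      (\<Sum>m<N. w p m * factorial_power (of_nat m) t (p' - 1)) = (if p = p' then 1 else 0)"
    using dual_functionals_factorial_powers[OF inj] by blast
  define ps where "ps = descending S\<^sub>0"
  \<comment> \<open>The weight of the point \<open>g\<close> under the tensor product of the functionals dual to \<open>ps\<close>.\<close>
  define pick where "pick g x = (\<Prod>c<n. w (ps ! c) (g c)) * x" for g x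
  have nth: "descending S ! i \<in> S" "descending S ! i \<in> {1..N}" if "S \<in> position_sets n N" "i < n" for S i
  proof -
    have "descending S ! i \<in> set (descending S)"
      using that by (intro nth_mem) (simp add: position_sets_def)
    then show "descending S ! i \<in> S" using position_sets_finite[OF that(1)] by simp
    then show "descending S ! i \<in> {1..N}" using that(1) by (auto simp: position_sets_def)
  qed
  have dual: "(\<Sum>g\<in>{..<n} \<rightarrow>\<^sub>E {..<N}.
      pick g (alternant t (descending S) (map of_nat (map g [0..<n])))) = (if S = S\<^sub>0 then 1 else 0)"
    if S: "S \<in> position_sets n N" for S
  proof -
    have at: "alternant t (descending S) (map of_nat (map g [0..<n]))
        = det (mat n n (\<lambda>(i, c). factorial_power (of_nat (g c)) t (descending S ! i - 1)))" for g
    proof -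
      have len: "length (map of_nat (map g [0..<n]) :: 'a list) = n" by simp
      show ?thesis unfolding alternant_def len
        by (rule arg_cong[of _ _ det], rule eq_matI) simp_all
    qed
    have "(\<Sum>g\<in>{..<n} \<rightarrow>\<^sub>E {..<N}. pick g (alternant t (descending S) (map of_nat (map g [0..<n]))))
        = (\<Sum>g\<in>{..<n} \<rightarrow>\<^sub>E {..<N}. (\<Prod>c<n. w (ps ! c) (g c)) * det (mat n n
            (\<lambda>(i, c). factorial_power (of_nat (g c)) t (descending S ! i - 1))))"
      unfolding pick_def at by (rule refl)
    also have "\<dots> = det (mat n n
        (\<lambda>(i, c). \<Sum>m<N. w (ps ! c) m * factorial_power (of_nat m) t (descending S ! i - 1)))"
      by (rule det_sum_columns[symmetric]) simp
    also have "\<dots> = det (mat n n (\<lambda>(i, c). if ps ! c = descending S ! i then 1 else 0 :: 'a))"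
      using w nth(2)[OF S] nth(2)[OF S\<^sub>0]
      by (intro arg_cong[of _ _ det] eq_matI) (auto simp: ps_def)
    also have "\<dots> = (if S = S\<^sub>0 then 1 else 0)"
    proof (cases "S = S\<^sub>0")
      case True
      have "distinct ps" "length ps = n" using S\<^sub>0 by (simp_all add: ps_def position_sets_def)
      then have "mat n n (\<lambda>(i, c). if ps ! c = descending S ! i then 1 else 0 :: 'a) = 1\<^sub>m n"
        using True by (intro eq_matI) (auto simp: ps_def[symmetric] nth_eq_iff_index_eq)
      then show ?thesis using True by simp
    next
      case False
      have "card S = card S\<^sub>0" using S S\<^sub>0 by (simp add: position_sets_def)
      then have "\<not> S \<subseteq> S\<^sub>0"
        using False position_sets_finite[OF S\<^sub>0] card_subset_eq by blast
      then obtain p where p: "p \<in> S" "p \<notin> S\<^sub>0" by blast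
      have "set (descending S) = S" "length (descending S) = n"
        using S position_sets_finite[OF S] by (simp_all add: position_sets_def)
      then obtain i where i: "i < n" "descending S ! i = p" using p(1) by (metis in_set_conv_nth)
      have "ps ! c \<noteq> p" if "c < n" for c using nth(1)[OF S\<^sub>0 that] p(2) by (auto simp: ps_def)
      then have "det (mat n n (\<lambda>(i, c). if ps ! c = descending S ! i then 1 else 0 :: 'a)) = 0"
        using i by (subst laplace_expansion_row[OF _ i(1)]) auto
      then show ?thesis using False by simp
    qed
    finally show ?thesis .
  qed
  have recover: "(\<Sum>g\<in>{..<n} \<rightarrow>\<^sub>E {..<N}. pick g (alternant_pairing t n N u (map of_nat (map g [0..<n]))))
      = u (word_of_set N S\<^sub>0)" for u :: "'a tensor"
  proof -
    have "(\<Sum>g\<in>{..<n} \<rightarrow>\<^sub>E {..<N}. pick g (alternant_pairing t n N u (map of_nat (map g [0..<n]))))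
        = (\<Sum>g\<in>{..<n} \<rightarrow>\<^sub>E {..<N}. \<Sum>S\<in>position_sets n N. u (word_of_set N S)
            * pick g (alternant t (descending S) (map of_nat (map g [0..<n]))))"
      by (simp add: alternant_pairing_def pick_def sum_distrib_left mult.left_commute)
    also have "\<dots> = (\<Sum>S\<in>position_sets n N. \<Sum>g\<in>{..<n} \<rightarrow>\<^sub>E {..<N}. u (word_of_set N S)
            * pick g (alternant t (descending S) (map of_nat (map g [0..<n]))))"
      by (rule sum.swap)
    also have "\<dots> = (\<Sum>S\<in>position_sets n N. u (word_of_set N S) * (if S = S\<^sub>0 then 1 else 0))"
      by (intro sum.cong refl) (simp only: sum_distrib_left[symmetric] dual)
    also have "\<dots> = u (word_of_set N S\<^sub>0)"
      using S\<^sub>0 finite_position_sets by (simp add: if_distrib[of "(*) _"] cong: if_cong)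
    finally show ?thesis .
  qed
  have "alternant_pairing t n N v (map of_nat (map g [0..<n]))
      = alternant_pairing t n N v' (map of_nat (map g [0..<n]))" for g
    by (rule eq) simp
  then show ?thesis using recover[of v] recover[of v'] by simp
qed

lemma bold_s_apply:
  "bold_s s t j v e = s j (v e - (t j - t (Suc j)) *
     (if e j = 1 \<and> e (Suc j) = 0 then v (e \<circ> adj_transp j) else 0))"
  by (simp add: bold_s_def r_hat_def delta_dual_apply)

text \<open>
  If \<open>S\<close> contains \<open>Suc j\<close> but not \<open>j\<close>, the alternant of \<open>S\<close> acquires under \<open>s j\<close> a multiple of the
  alternant of the swapped set, and \<open>bold_s\<close> adds the same multiple of the coefficient at \<open>S\<close> to the
  coefficient at the swapped set. The two sums differ by reindexing with the swap.
\<close>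

lemma alternant_pairing_bold_s:
  fixes t :: "nat \<Rightarrow> 'a::comm_ring_1"
  assumes "comm_ring_hom (s j)" "j \<in> {1..<N}" "\<And>i. i \<in> {1..N} \<Longrightarrow> s j (t i) = t (adj_transp j i)"
    and "length x = n"
  shows "alternant_pairing t n N (bold_s s t j v) (map (s j) x) = s j (alternant_pairing t n N v x)"
proof -
  interpret comm_ring_hom "s j" by fact
  let ?h = "s j" and ?V = "\<lambda>S. s j (v (word_of_set N S))"
  let ?a = "\<lambda>S. alternant t (descending S) (map (s j) x)"
  let ?d = "t j - t (Suc j)"
  have j: "j \<in> {1..N}" "Suc j \<in> {1..N}" using assms(2) by auto
  have hd: "?h (t j) = t (Suc j)" "?h (t (Suc j)) = t j"
    using assms(3)[OF j(1)] assms(3)[OF j(2)] by simp_all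
  have lhs: "bold_s s t j v (word_of_set N S)
      = ?V S + (if j \<in> S \<and> Suc j \<notin> S then ?d * ?V (adj_transp j ` S) else 0)" for S
    using j by (simp add: bold_s_apply word_of_set_eq_1_iff word_of_set_eq_0_iff word_of_set_adj[OF assms(2)]
        hom_add hom_minus hom_mult hd algebra_simps del: One_nat_def)
  have "(\<Sum>S\<in>position_sets n N. if j \<in> S \<and> Suc j \<notin> S then ?d * ?V (adj_transp j ` S) * ?a S else 0)
      = (\<Sum>S\<in>position_sets n N. if Suc j \<in> S \<and> j \<notin> S then ?d * ?V S * ?a (adj_transp j ` S) else 0)"
    by (rule sum.reindex_bij_witness[of _ "(`) (adj_transp j)" "(`) (adj_transp j)"])
      (use adj_position_sets[OF assms(2)] in \<open>simp_all add: image_image mem_adj_image_iff\<close>)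
  moreover have "?h (alternant_pairing t n N v x)
      = (\<Sum>S\<in>position_sets n N. ?V S * ?h (alternant t (descending S) x))"
    by (simp add: alternant_pairing_def hom_sum hom_mult)
  moreover have "\<dots> = (\<Sum>S\<in>position_sets n N. ?V S * ?a S +
      (if Suc j \<in> S \<and> j \<notin> S then ?d * ?V S * ?a (adj_transp j ` S) else 0))"
  proof (rule sum.cong[OF refl])
    fix S assume S: "S \<in> position_sets n N"
    have "?h (alternant t (descending S) x)
      = ?a S + (if Suc j \<in> S \<and> j \<notin> S then ?d * ?a (adj_transp j ` S) else 0)"
      using assms(3) by (rule hom_alternant_adj[where a = t and h = "s j" and j = j and N = N and n = n,
          OF comm_ring_hom_axioms assms(2) _ S assms(4)])
    then show "?V S * ?h (alternant t (descending S) x) = ?V S * ?a S +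
      (if Suc j \<in> S \<and> j \<notin> S then ?d * ?V S * ?a (adj_transp j ` S) else 0)"
      by (simp add: algebra_simps)
  qed
  moreover have "alternant_pairing t n N (bold_s s t j v) (map ?h x)
      = (\<Sum>S\<in>position_sets n N. ?V S * ?a S
          + (if j \<in> S \<and> Suc j \<notin> S then ?d * ?V (adj_transp j ` S) * ?a S else 0))"
    unfolding alternant_pairing_def lhs by (intro sum.cong) (auto simp: algebra_simps)
  ultimately show ?thesis by (simp add: sum.distrib)
qed

section \<open>Stability of the weight module\<close>

lemma int_polys_diff:
  assumes "a \<in> int_polys N T q" "b \<in> int_polys N T q"
  shows "a - b \<in> int_polys N T q"
proof -
  have "a + of_int (- 1) * b \<in> int_polys N T q"
    using assms by (intro int_polys.intros)
  then show ?thesis by simp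
qed

lemma hom_int_polys:
  assumes "comm_ring_hom h" "h q = q" "\<And>i. i \<in> {1..N} \<Longrightarrow> h (T i) \<in> T ` {1..N}"
    and "a \<in> int_polys N T q"
  shows "h a \<in> int_polys N T q"
proof -
  interpret comm_ring_hom h by fact
  show ?thesis using assms(4)
  proof induction
    case (param i)
    then show ?case using assms(3) by (metis imageE int_polys.param)
  qed (auto simp: hom_distribs assms(2) intro: int_polys.intros)
qed

lemma homs_agree_on_int_polys:
  assumes "comm_ring_hom h" "comm_ring_hom h'" "h q = h' q" "\<And>i. i \<in> {1..N} \<Longrightarrow> h (T i) = h' (T i)"
    and "a \<in> int_polys N T q"
  shows "h a = h' a"
proof -
  interpret h: comm_ring_hom h by fact
  interpret h': comm_ring_hom h' by fact
  show ?thesis using assms(5)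
    by induction (simp_all add: h.hom_add h'.hom_add h.hom_mult h'.hom_mult h.hom_of_int h'.hom_of_int assms(3,4))
qed

lemma words01_adj:
  assumes "j \<in> {1..<n + k}"
  shows "e \<circ> adj_transp j \<in> words01 n k \<longleftrightarrow> e \<in> words01 n k"
proof -
  have "e \<circ> adj_transp j \<in> words01 n k" if "e \<in> words01 n k" for e
    using that word_of_set_adj[OF assms] adj_position_sets[OF assms] by (auto simp: words01_eq)
  from this[of e] this[of "e \<circ> adj_transp j"] show ?thesis by (auto simp: comp_assoc)
qed

lemma bold_s_weight_module:
  assumes "comm_ring_hom (s j)" "s j q = q" "j \<in> {1..<n + k}"
    and "\<And>i. i \<in> {1..n + k} \<Longrightarrow> s j (T i) \<in> T ` {1..n + k}"
    and "t j \<in> int_polys (n + k) T q" "t (Suc j) \<in> int_polys (n + k) T q"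
    and "v \<in> weight_module n k T q"
  shows "bold_s s t j v \<in> weight_module n k T q"
proof -
  interpret comm_ring_hom "s j" by fact
  let ?R = "int_polys (n + k) T q"
  have v: "v e \<in> ?R" "e \<notin> words01 n k \<Longrightarrow> v e = 0" for e
    using assms(7) by (auto simp: weight_module_def)
  have "(0 :: 'a) \<in> ?R" using int_polys.const[of 0] by simp
  then have "bold_s s t j v e \<in> ?R" for e
    unfolding bold_s_apply
    by (intro hom_int_polys[OF comm_ring_hom_axioms assms(2,4)] int_polys_diff int_polys.mult assms(5,6) v)
      (simp_all add: v)
  moreover have "bold_s s t j v e = 0" if "e \<notin> words01 n k" for e
    using that v(2) words01_adj[OF assms(3)] by (simp add: bold_s_apply)
  ultimately show ?thesis by (simp add: weight_module_def)
qed

section \<open>The action of the symmetric group\<close>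

lemma permutes_adjacent_induct [consumes 1, case_names id adj_transp]:
  fixes \<sigma> :: "nat \<Rightarrow> nat"
  assumes "\<sigma> permutes {1..N}"
    and id: "P id"
    and adj_transp: "\<And>j \<sigma>. j \<in> {1..<N} \<Longrightarrow> \<sigma> permutes {1..N} \<Longrightarrow> P \<sigma> \<Longrightarrow> P (adj_transp j \<circ> \<sigma>)"
  shows "P \<sigma>"
proof -
  have word: "P (apply_adj_transps xs \<circ> \<tau>) \<and> apply_adj_transps xs \<circ> \<tau> permutes {1..N}"
    if "set xs \<subseteq> {1..<N}" "P \<tau>" "\<tau> permutes {1..N}" for xs \<tau>
    using that
  proof (induction xs)
    case (Cons x xs)
    have x: "x \<in> {1..<N}" using Cons.prems(1) by simp
    then have adj_x: "adj_transp x permutes {1..N}" by (intro permutes_swap_id) auto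
    have IH: "P (apply_adj_transps xs \<circ> \<tau>)" "apply_adj_transps xs \<circ> \<tau> permutes {1..N}"
      using Cons.IH[OF _ Cons.prems(2,3)] Cons.prems(1) unfolding list.set insert_subset by blast+
    have "adj_transp x \<circ> (apply_adj_transps xs \<circ> \<tau>) permutes {1..N}"
      by (rule permutes_compose[OF IH(2) adj_x])
    moreover have "P (adj_transp x \<circ> (apply_adj_transps xs \<circ> \<tau>))" by (rule adj_transp[OF x IH(2,1)])
    moreover have "apply_adj_transps (x # xs) \<circ> \<tau> = adj_transp x \<circ> (apply_adj_transps xs \<circ> \<tau>)"
      by (simp add: comp_assoc)
    ultimately show ?case by (simp only:)
  qed simp
  have "P \<sigma> \<and> \<sigma> permutes {1..N}"
    using assms(1) finite_atLeastAtMost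
  proof (induction rule: permutes_induct)
    case id
    show ?case using assms(2) permutes_id by blast
  next
    case (swap a b p)
    \<comment> \<open>The word of adjacent transpositions is available for ordered pairs only.\<close>
    define c where "c = min a b"
    define d where "d = max a b"
    have cd: "c < d" "transpose a b = transpose c d" "c \<ge> 1" "d \<le> N"
      using swap by (auto simp: c_def d_def min_def max_def transpose_commute)
    have "set (adj_transp_seq c d) \<subseteq> {1..<N}" using cd set_adj_transp_seq by auto
    then show ?case
      using word[of "adj_transp_seq c d" p] swap.IH swap.hyps(4)
      unfolding adj_transp_seq_correct[OF cd(1)] cd(2) by blast
  qed
  then show ?thesis by blast
qed

text \<open>
  A way to obtain a group action from operators for the adjacent transpositions without checking
  relations between them: it suffices to have a multiplicative relation between permutations and
  operators that contains the given pairs and is single-valued on \<open>E\<close>. Choosing for each permutation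
  some related operator is then a homomorphism, and operators of inverse permutations are mutually
  inverse.
\<close>

lemma sym_group_action_from_lifts:
  fixes E :: "'v set" and B :: "nat \<Rightarrow> 'v \<Rightarrow> 'v" and lifts :: "(nat \<Rightarrow> nat) \<Rightarrow> ('v \<Rightarrow> 'v) \<Rightarrow> bool"
  assumes one: "lifts id id"
    and gen: "\<And>j. j \<in> {1..<N} \<Longrightarrow> lifts (adj_transp j) (B j)"
    and comp: "\<And>\<sigma> \<tau> \<Phi> \<Psi>. \<sigma> permutes {1..N} \<Longrightarrow> \<tau> permutes {1..N} \<Longrightarrow>
      lifts \<sigma> \<Phi> \<Longrightarrow> lifts \<tau> \<Psi> \<Longrightarrow> lifts (\<sigma> \<circ> \<tau>) (\<Phi> \<circ> \<Psi>)"
    and closed: "\<And>\<sigma> \<Phi> v. lifts \<sigma> \<Phi> \<Longrightarrow> v \<in> E \<Longrightarrow> \<Phi> v \<in> E"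
    and unique: "\<And>\<sigma> \<Phi> \<Psi> v. lifts \<sigma> \<Phi> \<Longrightarrow> lifts \<sigma> \<Psi> \<Longrightarrow> v \<in> E \<Longrightarrow> \<Phi> v = \<Psi> v"
  shows "\<exists>\<phi>. group_action (sym_group N) E \<phi> \<and> (\<forall>j\<in>{1..<N}. \<forall>v\<in>E. \<phi> (adj_transp j) v = B j v)"
proof -
  have ex: "\<exists>\<Phi>. lifts \<sigma> \<Phi>" if "\<sigma> permutes {1..N}" for \<sigma>
    using that
  proof (induction rule: permutes_adjacent_induct)
    case id
    show ?case using one by blast
  next
    case (adj_transp j \<sigma>)
    have "adj_transp j permutes {1..N}" using adj_transp(1) by (intro permutes_swap_id) auto
    then show ?case using comp gen adj_transp by blast
  qed
  define L where "L \<sigma> = (SOME \<Phi>. lifts \<sigma> \<Phi>)" for \<sigma>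
  have L: "lifts \<sigma> (L \<sigma>)" if "\<sigma> permutes {1..N}" for \<sigma>
    unfolding L_def by (rule someI_ex[OF ex[OF that]])
  define \<phi> where "\<phi> \<sigma> = restrict (L \<sigma>) E" for \<sigma>
  have L_comp: "L (\<sigma> \<circ> \<tau>) v = L \<sigma> (L \<tau> v)"
    if "\<sigma> permutes {1..N}" "\<tau> permutes {1..N}" "v \<in> E" for \<sigma> \<tau> v
    using unique[OF L[OF permutes_compose[OF that(2,1)]] comp[OF that(1,2) L[OF that(1)] L[OF that(2)]] that(3)]
    by simp
  have L_id: "L id v = v" if "v \<in> E" for v
    using unique[OF L[OF permutes_id] one that] by simp
  have bij: "\<phi> \<sigma> \<in> Bij E" if \<sigma>: "\<sigma> permutes {1..N}" for \<sigma>
  proof -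
    have inv: "inv' \<sigma> permutes {1..N}" by (rule permutes_inv[OF \<sigma>])
    have "L \<sigma> (L (inv' \<sigma>) v) = v" "L (inv' \<sigma>) (L \<sigma> v) = v" if "v \<in> E" for v
      using L_comp[OF \<sigma> inv that] L_comp[OF inv \<sigma> that] L_id[OF that]
        permutes_inv_o[OF \<sigma>] by simp_all
    then have "bij_betw (L \<sigma>) E E"
      by (intro bij_betw_byWitness[of _ "L (inv' \<sigma>)"]) (auto intro: closed L \<sigma> inv)
    then have "bij_betw (\<phi> \<sigma>) E E" unfolding \<phi>_def
      by (subst bij_betw_cong[of _ _ "L \<sigma>"]) auto
    then show ?thesis by (simp add: Bij_def \<phi>_def)
  qed
  have "\<phi> \<in> hom (sym_group N) (BijGroup E)"
  proof (rule homI)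
    fix \<sigma> \<tau> assume \<sigma>: "\<sigma> \<in> carrier (sym_group N)" "\<tau> \<in> carrier (sym_group N)"
    then have p: "\<sigma> permutes {1..N}" "\<tau> permutes {1..N}" by (simp_all add: sym_group_carrier)
    have "\<phi> (\<sigma> \<circ> \<tau>) = compose E (\<phi> \<sigma>) (\<phi> \<tau>)"
      by (rule ext) (simp add: \<phi>_def compose_def L_comp[OF p] closed[OF L[OF p(2)]])
    then show "\<phi> (\<sigma> \<otimes>\<^bsub>sym_group N\<^esub> \<tau>) = \<phi> \<sigma> \<otimes>\<^bsub>BijGroup E\<^esub> \<phi> \<tau>"
      using bij p by (simp add: BijGroup_def sym_group_mult)
  qed (simp add: BijGroup_def sym_group_carrier bij)
  then have "group_action (sym_group N) E \<phi>"
    by (simp add: group_action_def group_hom_def group_hom_axioms_def sym_group_is_group group_BijGroup)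
  moreover have "\<phi> (adj_transp j) v = B j v" if "j \<in> {1..<N}" "v \<in> E" for j v
  proof -
    have "adj_transp j permutes {1..N}" using that(1) by (intro permutes_swap_id) auto
    then show ?thesis using unique[OF L gen[OF that(1)] that(2)] that(2) by (simp add: \<phi>_def)
  qed
  ultimately show ?thesis by blast
qed

text \<open>
  The operator \<open>\<Phi>\<close> becomes, under the pairing, a ring homomorphism that acts on the parameters by \<open>\<sigma>\<close>.
  The points of evaluation are natural numbers because these are fixed by every ring homomorphism.
\<close>

definition semilinear_lift ::
  "nat \<Rightarrow> nat \<Rightarrow> (nat \<Rightarrow> 'r::comm_ring_1) \<Rightarrow> (nat \<Rightarrow> 'r) \<Rightarrow> 'r \<Rightarrow> (nat \<Rightarrow> nat) \<Rightarrow>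
    ('r tensor \<Rightarrow> 'r tensor) \<Rightarrow> bool" where
  "semilinear_lift n k T t q \<sigma> \<Phi> \<longleftrightarrow>
     (\<exists>h. comm_ring_hom h \<and> h q = q \<and> (\<forall>i\<in>{1..n + k}. h (t i) = t (\<sigma> i)) \<and>
        (\<forall>v\<in>weight_module n k T q. \<Phi> v \<in> weight_module n k T q \<and>
           (\<forall>x. length x = n \<longrightarrow> alternant_pairing t n (n + k) (\<Phi> v) (map of_nat x)
              = h (alternant_pairing t n (n + k) v (map of_nat x)))))"

text \<open>
  A lift of \<open>\<sigma>\<close> is unique on the weight module: two ring homomorphisms that agree on the parameters and
  on \<open>q\<close> agree on the coefficients of a vector and on all alternants, hence on the values of the
  pairing, and these determine the image vector.
\<close>

lemma bold_s_sym_group_action: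
  fixes T t :: "nat \<Rightarrow> 'r::field"
  assumes inj: "inj (of_nat :: nat \<Rightarrow> 'r)"
    and T: "\<And>i. i \<in> {1..n + k} \<Longrightarrow> T i = t (n + k + 1 - i)"
    and hom: "\<And>j. j \<in> {1..<n + k} \<Longrightarrow> comm_ring_hom (s j)"
    and q: "\<And>j. j \<in> {1..<n + k} \<Longrightarrow> s j q = q"
    and t: "\<And>i j. j \<in> {1..<n + k} \<Longrightarrow> i \<in> {1..n + k} \<Longrightarrow> s j (t i) = t (adj_transp j i)"
  shows "\<exists>\<phi>. group_action (sym_group (n + k)) (weight_module n k T q) \<phi> \<and>
    (\<forall>j\<in>{1..<n + k}. \<forall>v\<in>weight_module n k T q. \<phi> (adj_transp j) v = bold_s s t j v)"
proof (rule sym_group_action_from_lifts[where lifts = "semilinear_lift n k T t q"])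
  let ?E = "weight_module n k T q" and ?N = "n + k"
  let ?pair = "alternant_pairing t n (n + k)"
  have T_t: "t i = T (?N + 1 - i)" "?N + 1 - i \<in> {1..?N}" if "i \<in> {1..?N}" for i
  proof -
    show "?N + 1 - i \<in> {1..?N}" using that by auto
    then show "t i = T (?N + 1 - i)" using T[of "?N + 1 - i"] that by simp
  qed
  have "comm_ring_hom (id :: 'r \<Rightarrow> 'r)" by unfold_locales auto
  then show "semilinear_lift n k T t q id id"
    unfolding semilinear_lift_def by (intro exI[of _ id]) auto
  show "semilinear_lift n k T t q (adj_transp j) (bold_s s t j)" if j: "j \<in> {1..<?N}" for j
    unfolding semilinear_lift_def
  proof (intro exI[of _ "s j"] conjI ballI allI impI)
    interpret comm_ring_hom "s j" by (rule hom[OF j])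
    show "comm_ring_hom (s j)" "s j q = q" "\<And>i. i \<in> {1..?N} \<Longrightarrow> s j (t i) = t (adj_transp j i)"
      using hom q t j by auto
    fix v assume v: "v \<in> ?E"
    have "s j (T i) \<in> T ` {1..?N}" if i: "i \<in> {1..?N}" for i
    proof -
      have "s j (T i) = t (adj_transp j (?N + 1 - i))" using T[OF i] t[OF j T_t(2)[OF i]] by simp
      then show ?thesis
        using T_t[of "adj_transp j (?N + 1 - i)"] adj_mem_iff[OF j] T_t(2)[OF i] by auto
    qed
    moreover have "t i \<in> int_polys ?N T q" if "i \<in> {1..?N}" for i
      using T_t[OF that] int_polys.param[of "?N + 1 - i" ?N T q] by simp
    ultimately show "bold_s s t j v \<in> ?E"
      using j by (intro bold_s_weight_module hom q v) auto
    fix x :: "nat list" assume "length x = n"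
    then have "?pair (bold_s s t j v) (map (s j) (map of_nat x)) = s j (?pair v (map of_nat x))"
      using j t by (intro alternant_pairing_bold_s hom) auto
    then show "?pair (bold_s s t j v) (map of_nat x) = s j (?pair v (map of_nat x))"
      by (simp add: o_def hom_of_nat)
  qed
  show "semilinear_lift n k T t q (\<sigma> \<circ> \<tau>) (\<Phi> \<circ> \<Psi>)"
    if \<sigma>: "\<sigma> permutes {1..?N}" and \<tau>: "\<tau> permutes {1..?N}"
      and lifts: "semilinear_lift n k T t q \<sigma> \<Phi>" "semilinear_lift n k T t q \<tau> \<Psi>" for \<sigma> \<tau> \<Phi> \<Psi>
  proof -
    obtain h where h: "comm_ring_hom h" "h q = q" "\<And>i. i \<in> {1..?N} \<Longrightarrow> h (t i) = t (\<sigma> i)"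
      "\<And>v. v \<in> ?E \<Longrightarrow> \<Phi> v \<in> ?E"
      "\<And>v x. v \<in> ?E \<Longrightarrow> length x = n \<Longrightarrow> ?pair (\<Phi> v) (map of_nat x) = h (?pair v (map of_nat x))"
      using lifts(1) unfolding semilinear_lift_def by blast
    obtain h' where h': "comm_ring_hom h'" "h' q = q" "\<And>i. i \<in> {1..?N} \<Longrightarrow> h' (t i) = t (\<tau> i)"
      "\<And>v. v \<in> ?E \<Longrightarrow> \<Psi> v \<in> ?E"
      "\<And>v x. v \<in> ?E \<Longrightarrow> length x = n \<Longrightarrow> ?pair (\<Psi> v) (map of_nat x) = h' (?pair v (map of_nat x))"
      using lifts(2) unfolding semilinear_lift_def by blast
    interpret h: comm_ring_hom h by fact
    interpret h': comm_ring_hom h' by fact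
    have "comm_ring_hom (h \<circ> h')"
      by unfold_locales (simp_all add: h.hom_add h'.hom_add h.hom_mult h'.hom_mult)
    then show ?thesis
      unfolding semilinear_lift_def using permutes_in_image[OF \<tau>]
      by (intro exI[of _ "h \<circ> h'"] conjI ballI allI impI) (simp_all only: o_apply h h')
  qed
  show "\<Phi> v \<in> ?E" if "semilinear_lift n k T t q \<sigma> \<Phi>" "v \<in> ?E" for \<sigma> \<Phi> v
    using that unfolding semilinear_lift_def by blast
  show "\<Phi> v = \<Psi> v"
    if lifts: "semilinear_lift n k T t q \<sigma> \<Phi>" "semilinear_lift n k T t q \<sigma> \<Psi>" and v: "v \<in> ?E" for \<sigma> \<Phi> \<Psi> v
  proof -
    obtain h where h: "comm_ring_hom h" "h q = q" "\<And>i. i \<in> {1..?N} \<Longrightarrow> h (t i) = t (\<sigma> i)" "\<Phi> v \<in> ?E"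
      "\<And>x. length x = n \<Longrightarrow> ?pair (\<Phi> v) (map of_nat x) = h (?pair v (map of_nat x))"
      using lifts(1) v unfolding semilinear_lift_def by blast
    obtain h' where h': "comm_ring_hom h'" "h' q = q" "\<And>i. i \<in> {1..?N} \<Longrightarrow> h' (t i) = t (\<sigma> i)" "\<Psi> v \<in> ?E"
      "\<And>x. length x = n \<Longrightarrow> ?pair (\<Psi> v) (map of_nat x) = h' (?pair v (map of_nat x))"
      using lifts(2) v unfolding semilinear_lift_def by blast
    interpret h: comm_ring_hom h by fact
    interpret h': comm_ring_hom h' by fact
    have coeff: "h (v e) = h' (v e)" for e
    proof (rule homs_agree_on_int_polys[OF h(1) h'(1)])
      show "h q = h' q" using h(2) h'(2) by simp
      show "h (T i) = h' (T i)" if "i \<in> {1..?N}" for i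
        using T[OF that] h(3)[OF T_t(2)[OF that]] h'(3)[OF T_t(2)[OF that]] by simp
      show "v e \<in> int_polys ?N T q" using v by (simp add: weight_module_def)
    qed
    have alt: "h (alternant t (descending S) (map of_nat x)) = h' (alternant t (descending S) (map of_nat x))"
      if "S \<in> position_sets n ?N" "length x = n" for S x
    proof -
      have "map h (map of_nat x) = map of_nat x" "map h' (map of_nat x) = map of_nat x"
        by (simp_all add: h.hom_of_nat h'.hom_of_nat)
      moreover have "alternant (\<lambda>i. h (t i)) (descending S) (map of_nat x)
          = alternant (\<lambda>i. h' (t i)) (descending S) (map of_nat x)"
        by (rule alternant_cong[of _ ?N])
          (use that position_sets_finite[OF that(1)] h(3) h'(3) in \<open>simp_all add: position_sets_def\<close>)
      ultimately show ?thesis by (simp only: h.hom_alternant h'.hom_alternant)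
    qed
    have "h (?pair v (map of_nat x)) = h' (?pair v (map of_nat x))" if "length x = n" for x
      unfolding alternant_pairing_def h.hom_sum h'.hom_sum h.hom_mult h'.hom_mult
      by (intro sum.cong refl) (simp only: coeff alt that)
    then have "?pair (\<Phi> v) (map of_nat x) = ?pair (\<Psi> v) (map of_nat x)" if "length x = n" for x
      using h(5) h'(5) that by simp
    then have "\<Phi> v (word_of_set ?N S) = \<Psi> v (word_of_set ?N S)" if "S \<in> position_sets n ?N" for S
      by (rule alternant_pairing_faithful[OF inj _ that])
    then have "\<Phi> v e = \<Psi> v e" if "e \<in> words01 n k" for e
      using that by (auto simp: words01_eq)
    moreover have "\<Phi> v e = \<Psi> v e" if "e \<notin> words01 n k" for e
      using that h(4) h'(4) by (simp add: weight_module_def)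
    ultimately show ?thesis by blast
  qed
qed

section \<open>Bethe vectors\<close>

lemma bethe_vector_word01:
  assumes "l \<in> partitions_in_box n k"
  shows "bethe_vector n k T y \<alpha> (word01 n k l)
    = factorial_schur (dual_partition k l) (root_tuple n y \<alpha>) T"
proof -
  have fin: "finite (partitions_in_box n k)"
    by (rule inj_on_finite[of "one_positions n" _ "position_sets n (n + k)"])
      (auto simp: inj_on_def finite_position_sets intro: one_positions_inj one_positions_in_position_sets)
  have "bethe_vector n k T y \<alpha> (word01 n k l) = (\<Sum>m\<in>partitions_in_box n k.
      if m = l then factorial_schur (dual_partition k l) (root_tuple n y \<alpha>) T else 0)"
    unfolding bethe_vector_def
    by (intro sum.cong refl) (use assms word01_inj in \<open>auto simp: ket_def\<close>)
  then show ?thesis using assms fin by simp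
qed

lemma bethe_vector_eq_0:
  assumes "\<And>l. l \<in> partitions_in_box n k \<Longrightarrow> e \<noteq> word01 n k l"
  shows "bethe_vector n k T y \<alpha> e = 0"
  unfolding bethe_vector_def using assms by (intro sum.neutral) (auto simp: ket_def)

text \<open>
  The parameters \<open>T\<close> are the parameters \<open>t\<close> in reverse order, so exchanging \<open>t_j\<close> and \<open>t_{j+1}\<close> amounts to
  exchanging \<open>T_{N-j}\<close> and \<open>T_{N-j+1}\<close>. The word of the dual partition is reversed as well, so
  letters \<open>N - j\<close> and \<open>N - j + 1\<close> there are letters \<open>j + 1\<close> and \<open>j\<close> of the original word.
\<close>

lemma hom_dual_schur_at_roots:
  fixes t T y :: "nat \<Rightarrow> 'r::field" and h :: "'r \<Rightarrow> 'r"
  assumes hom: "field_hom h" and j: "j \<in> {1..<n + k}"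
    and t: "\<And>i. i \<in> {1..n + k} \<Longrightarrow> h (t i) = t (adj_transp j i)"
    and T: "\<And>i. i \<in> {1..n + k} \<Longrightarrow> T i = t (n + k + 1 - i)"
    and y: "\<And>i. i \<in> {1..n + k} \<Longrightarrow> h (y i) = y (adj_transp j i)"
    and l: "l \<in> partitions_in_box n k" and \<alpha>: "\<alpha> \<in> partitions_in_box n k"
  shows "h (factorial_schur (dual_partition k l) (root_tuple n y \<alpha>) T)
    = factorial_schur (dual_partition k l) (root_tuple n y (swap_letters n k j \<alpha>)) T
    + (if j \<in> one_positions n l \<and> Suc j \<notin> one_positions n l
       then (t (Suc j) - t j) * factorial_schur (dual_partition k (swap_letters n k j l))
              (root_tuple n y (swap_letters n k j \<alpha>)) T else 0)"
proof -
  define j' where "j' = n + k - j"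
  have j': "j' \<in> {1..<n + k}" "j' \<in> {1..n + k}" "Suc j' \<in> {1..n + k}"
    "n + k + 1 - j' = Suc j" "n + k + 1 - Suc j' = j"
    using j by (auto simp: j'_def)
  have hT: "h (T i) = T (adj_transp j' i)" if i: "i \<in> {1..n + k}" for i
  proof -
    have i': "n + k + 1 - i \<in> {1..n + k}" using i by auto
    have "n + k + 1 - adj_transp j' i = adj_transp j (n + k + 1 - i)"
      using i j by (auto simp: transpose_def j'_def)
    moreover have "adj_transp j' i \<in> {1..n + k}" using adj_mem_iff[OF j'(1)] i by blast
    ultimately show ?thesis using T[OF i] t[OF i'] T[of "adj_transp j' i"] by simp
  qed
  have "h (factorial_schur (dual_partition k l) (root_tuple n y \<alpha>) T)
    = factorial_schur (dual_partition k l) (root_tuple n y (swap_letters n k j \<alpha>)) T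
    + (if Suc j' \<in> one_positions n (dual_partition k l) \<and> j' \<notin> one_positions n (dual_partition k l)
       then (T j' - T (Suc j')) * factorial_schur (swap_letters n k j' (dual_partition k l))
              (root_tuple n y (swap_letters n k j \<alpha>)) T else 0)"
    by (intro hom_schur_at_roots hom j j' hT y dual_in_box l \<alpha>)
  moreover have "T j' = t (Suc j)" "T (Suc j') = t j"
    using T[OF j'(2)] T[OF j'(3)] j'(4,5) by simp_all
  ultimately show ?thesis
    unfolding mem_one_positions_dual[OF j'(2) l] mem_one_positions_dual[OF j'(3) l] j'(4,5)
    using dual_swap_letters[OF j l] by (simp only: j'_def)
qed

text \<open>
  At a word with letters 1, 0 in positions \<open>j\<close>, \<open>j + 1\<close>, the coefficient gains
  \<open>(t_{j+1} - t_j)\<close> times the coefficient of the swapped word from the exchange formula, and loses the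
  same from \<open>r_hat\<close>, whose factor \<open>t_j - t_{j+1}\<close> changes sign under \<open>s j\<close>. At all other words both
  corrections are absent.
\<close>

lemma bold_s_bethe_vector:
  fixes t T y :: "nat \<Rightarrow> 'r::field"
  assumes hom: "field_hom (s j)" and j: "j \<in> {1..<n + k}"
    and t: "\<And>i. i \<in> {1..n + k} \<Longrightarrow> s j (t i) = t (adj_transp j i)"
    and T: "\<And>i. i \<in> {1..n + k} \<Longrightarrow> T i = t (n + k + 1 - i)"
    and y: "\<And>i. i \<in> {1..n + k} \<Longrightarrow> s j (y i) = y (adj_transp j i)"
    and \<alpha>: "\<alpha> \<in> partitions_in_box n k"
  shows "bold_s s t j (bethe_vector n k T y \<alpha>) = bethe_vector n k T y (swap_letters n k j \<alpha>)"
proof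
  fix e
  interpret field_hom "s j" by fact
  let ?b = "bethe_vector n k T y \<alpha>" and ?b' = "bethe_vector n k T y (swap_letters n k j \<alpha>)"
  have st: "s j (t j) = t (Suc j)" "s j (t (Suc j)) = t j"
    using t[of j] t[of "Suc j"] j by auto
  show "bold_s s t j ?b e = ?b' e"
  proof (cases "\<exists>l\<in>partitions_in_box n k. e = word01 n k l")
    case True
    then obtain l where l: "l \<in> partitions_in_box n k" "e = word01 n k l" by blast
    let ?S = "one_positions n l"
    have exchange: "s j (?b (word01 n k m)) = ?b' (word01 n k m)
      + (if j \<in> one_positions n m \<and> Suc j \<notin> one_positions n m
         then (t (Suc j) - t j) * ?b' (word01 n k (swap_letters n k j m)) else 0)"
      if m: "m \<in> partitions_in_box n k" for m
      unfolding bethe_vector_word01[OF m] bethe_vector_word01[OF swap_letters(1)[OF j m]]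
      by (intro hom_dual_schur_at_roots hom j t T y m \<alpha>)
    have letters: "e j = 1 \<longleftrightarrow> j \<in> ?S" "e (Suc j) = 0 \<longleftrightarrow> Suc j \<notin> ?S"
      using j word_of_set_eq_1_iff[of j "n + k" ?S] word_of_set_eq_0_iff[of "Suc j" "n + k" ?S]
      by (simp_all add: l(2) word01_eq)
    have e': "e \<circ> adj_transp j = word01 n k (swap_letters n k j l)"
      by (simp only: l(2) word01_swap_letters[OF j l(1)])
    show ?thesis
    proof (cases "j \<in> ?S \<and> Suc j \<notin> ?S")
      case True
      \<comment> \<open>The swapped word has letters 0, 1 at these positions, so its own coefficient gains nothing.\<close>
      have "j \<notin> one_positions n (swap_letters n k j l)"
        using True unfolding swap_letters(2)[OF j l(1)] mem_adj_image_iff by simp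
      then have "s j (?b (e \<circ> adj_transp j)) = ?b' (e \<circ> adj_transp j)"
        using exchange[OF swap_letters(1)[OF j l(1)]] unfolding e' by simp
      then show ?thesis
        using True exchange[OF l(1)] letters
        by (simp add: bold_s_apply l(2)[symmetric] e'[symmetric] hom_add hom_minus hom_mult st
            del: One_nat_def comp_apply)
    next
      case False
      then show ?thesis
        using exchange[OF l(1)] letters by (auto simp add: bold_s_apply l(2)[symmetric])
    qed
  next
    case False
    have "e \<circ> adj_transp j \<noteq> word01 n k l" if l: "l \<in> partitions_in_box n k" for l
      using False swap_letters(1)[OF j l] word01_swap_letters[OF j l] comp_adj_eq_iff by metis
    then have "?b (e \<circ> adj_transp j) = 0" by (rule bethe_vector_eq_0)
    moreover have "?b e = 0" "?b' e = 0" using False by (auto intro!: bethe_vector_eq_0)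
    ultimately show ?thesis by (simp add: bold_s_apply)
  qed
qed

section \<open>The symmetric group permutes the Bethe vectors\<close>

theorem proposition5p13:
  fixes n k N :: nat
    and \<iota> :: "complex \<Rightarrow> 'k::alg_closed_field"
    and T\<^sub>0 t\<^sub>0 :: "nat \<Rightarrow> 'k"
    and s\<^sub>0 :: "nat \<Rightarrow> 'k \<Rightarrow> 'k"
    and T t y :: "nat \<Rightarrow> 'k fls"
    and q :: "'k fls"
    and s :: "nat \<Rightarrow> 'k fls \<Rightarrow> 'k fls"
  defines "N \<equiv> n + k"
    and "t\<^sub>0 \<equiv> \<lambda>i. T\<^sub>0 (N + 1 - i)"
    and "T \<equiv> \<lambda>i. fls_const (T\<^sub>0 i)"
    and "t \<equiv> \<lambda>i. fls_const (t\<^sub>0 i)"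
    and "q \<equiv> fls_X ^ N"
    and "s \<equiv> \<lambda>j. fls_map_coeffs (s\<^sub>0 j)"
  assumes "field_hom \<iota>"
    and "alg_independent \<iota> N T\<^sub>0"
    and "extends_exchanges \<iota> N t\<^sub>0 s\<^sub>0"
    and "bethe_roots n N t\<^sub>0 y"
  shows "(\<exists>\<phi>. group_action (sym_group N) (weight_module n k T q) \<phi> \<and>
            (\<forall>j\<in>{1..<N}. \<forall>v\<in>weight_module n k T q. \<phi> (transpose j (Suc j)) v = bold_s s t j v)) \<and>
         (\<forall>j\<in>{1..<N}. \<forall>\<alpha>\<in>partitions_in_box n k.
            bold_s s t j (bethe_vector n k T y \<alpha>) = bethe_vector n k T y (swap_letters n k j \<alpha>)) \<and>
         (\<forall>j\<in>{1..<N}. \<forall>\<alpha>\<in>partitions_in_box n k. \<forall>l\<in>partitions_in_box n k.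
            factorial_schur l (root_tuple n y \<alpha>) t
              - s j (factorial_schur l (root_tuple n y (swap_letters n k j \<alpha>)) t)
            = (t (Suc j) - t j) *
              (if delta_dual j (ket (word01 n k l) :: 'k fls tensor) = (\<lambda>_. 0) then 0
               else factorial_schur
                      (image_partition n k (delta_dual j :: 'k fls tensor \<Rightarrow> 'k fls tensor) l)
                      (root_tuple n y \<alpha>) t)) \<and>
         (\<forall>j\<in>{1..<N}. \<forall>\<alpha>\<in>partitions_in_box n k. \<forall>l\<in>partitions_in_box n k.
            factorial_schur (dual_partition k l) (root_tuple n y \<alpha>) T
              - s j (factorial_schur (dual_partition k l) (root_tuple n y (swap_letters n k j \<alpha>)) T)
            = (t j - t (Suc j)) *
              (if delta j (ket (word01 n k l) :: 'k fls tensor) = (\<lambda>_. 0) then 0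
               else factorial_schur
                      (dual_partition k
                        (image_partition n k (delta j :: 'k fls tensor \<Rightarrow> 'k fls tensor) l))
                      (root_tuple n y \<alpha>) T))"

proof -
  have T_t: "T i = t (N + 1 - i)" if "i \<in> {1..N}" for i
    using that by (simp add: T_def t_def t\<^sub>0_def)
  have hom\<^sub>0: "field_hom (s\<^sub>0 j)" and s\<^sub>0_t\<^sub>0: "\<And>i. i \<in> {1..N} \<Longrightarrow> s\<^sub>0 j (t\<^sub>0 i) = t\<^sub>0 (adj_transp j i)"
    if "j \<in> {1..<N}" for j
    using \<open>extends_exchanges \<iota> N t\<^sub>0 s\<^sub>0\<close> that unfolding extends_exchanges_def by blast+
  have hom: "field_hom (s j)" if "j \<in> {1..<N}" for j
    unfolding s_def by (rule field_hom_fls_map_coeffs[OF hom\<^sub>0[OF that]])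
  have zero: "s\<^sub>0 j 0 = 0" if "j \<in> {1..<N}" for j
  proof -
    interpret field_hom "s\<^sub>0 j" by (rule hom\<^sub>0[OF that])
    show ?thesis by simp
  qed
  have s_t: "s j (t i) = t (adj_transp j i)" if "j \<in> {1..<N}" "i \<in> {1..N}" for i j
    using that s\<^sub>0_t\<^sub>0 by (simp add: s_def t_def fls_map_coeffs_const zero)
  have s_q: "s j q = q" if "j \<in> {1..<N}" for j
  proof -
    interpret field_hom "s j" by (rule hom[OF that])
    show ?thesis unfolding q_def hom_power by (simp add: s_def fls_map_coeffs_X[OF hom\<^sub>0[OF that]])
  qed
  have inj_T: "inj_on T\<^sub>0 {1..N}" by (rule alg_independent_inj) fact+
  have inj: "inj_on t\<^sub>0 {1..N}"
  proof (rule inj_onI)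
    fix a b assume ab: "a \<in> {1..N}" "b \<in> {1..N}" "t\<^sub>0 a = t\<^sub>0 b"
    then have "N + 1 - a = N + 1 - b"
      by (intro inj_onD[OF inj_T]) (auto simp: t\<^sub>0_def)
    then show "a = b" using ab by auto
  qed
  have s_y: "s j (y i) = y (adj_transp j i)" if "j \<in> {1..<N}" "i \<in> {1..N}" for i j
    unfolding s_def
    using s\<^sub>0_t\<^sub>0[OF that(1)]
    by (rule fls_map_coeffs_bethe_root[OF hom\<^sub>0[OF that(1)] that(1) _ inj \<open>bethe_roots n N t\<^sub>0 y\<close> that(2)])
  \<comment> \<open>The characteristic is 0 because the complex numbers embed.\<close>
  have inj_nat: "inj (of_nat :: nat \<Rightarrow> 'k fls)"
  proof (rule injI)
    interpret field_hom \<iota> by fact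
    fix a b :: nat assume "(of_nat a :: 'k fls) = of_nat b"
    then have "fls_nth (of_nat a :: 'k fls) 0 = fls_nth (of_nat b) 0" by simp
    then have "\<iota> (of_nat a) = \<iota> (of_nat b)" by (simp add: hom_of_nat fls_of_nat_nth)
    then show "a = b" by simp
  qed
  have action: "\<exists>\<phi>. group_action (sym_group N) (weight_module n k T q) \<phi> \<and>
      (\<forall>j\<in>{1..<N}. \<forall>v\<in>weight_module n k T q. \<phi> (transpose j (Suc j)) v = bold_s s t j v)"
    unfolding N_def
  proof (rule bold_s_sym_group_action[OF inj_nat])
    show "comm_ring_hom (s j)" if "j \<in> {1..<n + k}" for j
    proof -
      interpret field_hom "s j" by (rule hom) (use that in \<open>simp add: N_def\<close>)
      show ?thesis by (rule comm_ring_hom_axioms)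
    qed
  qed (use T_t s_q s_t in \<open>simp_all add: N_def\<close>)
  have bethe: "bold_s s t j (bethe_vector n k T y \<alpha>) = bethe_vector n k T y (swap_letters n k j \<alpha>)"
    if "j \<in> {1..<N}" "\<alpha> \<in> partitions_in_box n k" for j \<alpha>
    using that hom s_t T_t s_y unfolding N_def by (intro bold_s_bethe_vector) auto
  have difference_t: "factorial_schur l (root_tuple n y \<alpha>) t
      - s j (factorial_schur l (root_tuple n y (swap_letters n k j \<alpha>)) t)
    = (t (Suc j) - t j) *
      (if delta_dual j (ket (word01 n k l) :: 'k fls tensor) = (\<lambda>_. 0) then 0
       else factorial_schur
              (image_partition n k (delta_dual j :: 'k fls tensor \<Rightarrow> 'k fls tensor) l)
              (root_tuple n y \<alpha>) t)"
    if j: "j \<in> {1..<N}" and \<alpha>: "\<alpha> \<in> partitions_in_box n k" and l: "l \<in> partitions_in_box n k" for j \<alpha> l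
  proof -
    have jN: "j \<in> {1..<n + k}" using j by (simp add: N_def)
    have s: "s j (factorial_schur l (root_tuple n y (swap_letters n k j \<alpha>)) t)
      = factorial_schur l (root_tuple n y \<alpha>) t
      + (if Suc j \<in> one_positions n l \<and> j \<notin> one_positions n l
         then (t j - t (Suc j)) * factorial_schur (swap_letters n k j l) (root_tuple n y \<alpha>) t else 0)"
      using hom_schur_at_roots[where h = "s j" and j' = j and j = j and a = t and y = y,
          OF hom[OF j] jN _ jN _ l swap_letters(1)[OF jN \<alpha>]] s_t[OF j] s_y[OF j]
      unfolding N_def swap_letters_swap_letters[OF jN \<alpha>] by blast
    note nz = delta_dual_ket_word01[OF jN l, where ?'r = "'k fls"]
    show ?thesis
    proof (cases "delta_dual j (ket (word01 n k l) :: 'k fls tensor) = (\<lambda>_. 0)")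
      case True
      then have "\<not> (Suc j \<in> one_positions n l \<and> j \<notin> one_positions n l)" using nz(1) by blast
      then show ?thesis using True unfolding s by auto
    next
      case False
      then have "Suc j \<in> one_positions n l \<and> j \<notin> one_positions n l" using nz(1) by blast
      then show ?thesis unfolding s nz(2)[OF False] using False by (simp add: algebra_simps)
    qed
  qed
  have difference_T: "factorial_schur (dual_partition k l) (root_tuple n y \<alpha>) T
      - s j (factorial_schur (dual_partition k l) (root_tuple n y (swap_letters n k j \<alpha>)) T)
    = (t j - t (Suc j)) *
      (if delta j (ket (word01 n k l) :: 'k fls tensor) = (\<lambda>_. 0) then 0
       else factorial_schur
              (dual_partition k
                (image_partition n k (delta j :: 'k fls tensor \<Rightarrow> 'k fls tensor) l))
              (root_tuple n y \<alpha>) T)"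
    if j: "j \<in> {1..<N}" and \<alpha>: "\<alpha> \<in> partitions_in_box n k" and l: "l \<in> partitions_in_box n k" for j \<alpha> l
  proof -
    have jN: "j \<in> {1..<n + k}" using j by (simp add: N_def)
    have s: "s j (factorial_schur (dual_partition k l) (root_tuple n y (swap_letters n k j \<alpha>)) T)
      = factorial_schur (dual_partition k l) (root_tuple n y \<alpha>) T
      + (if j \<in> one_positions n l \<and> Suc j \<notin> one_positions n l
         then (t (Suc j) - t j) * factorial_schur (dual_partition k (swap_letters n k j l))
                (root_tuple n y \<alpha>) T else 0)"
      using hom_dual_schur_at_roots[where h = "s j" and j = j and t = t and T = T and y = y,
          OF hom[OF j] jN _ _ _ l swap_letters(1)[OF jN \<alpha>]] s_t[OF j] T_t s_y[OF j]
      unfolding N_def swap_letters_swap_letters[OF jN \<alpha>] by blast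
    note nz = delta_ket_word01[OF jN l, where ?'r = "'k fls"]
    show ?thesis
    proof (cases "delta j (ket (word01 n k l) :: 'k fls tensor) = (\<lambda>_. 0)")
      case True
      then have "\<not> (j \<in> one_positions n l \<and> Suc j \<notin> one_positions n l)" using nz(1) by blast
      then show ?thesis using True unfolding s by auto
    next
      case False
      then have "j \<in> one_positions n l \<and> Suc j \<notin> one_positions n l" using nz(1) by blast
      then show ?thesis unfolding s nz(2)[OF False] using False by (simp add: algebra_simps)
    qed
  qed
  show ?thesis
    by (intro conjI ballI action bethe difference_t difference_T)
qed

end
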